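(* Let $*:\hat S\to\widehat{{}^*S}$ be an enlargement, and let $\langle\mathcal A,P\rangle$ be an additive $\hat S$-small category. Then: (i) $\langle{}^*\mathcal A,{}^*P\rangle$ is an additive $\widehat{{}^*S}$-small category, and the functor $*:\mathcal A\to{}^*\mathcal A$ is additive. (ii) If $\varphi[X,Y,Z,f,g]$ is the formula "$f:X\to Y$ is a morphism in $\mathcal A$ with kernel $g:Z\to X$" in $\hat S$, then ${}^*\varphi[X,Y,Z,f,g]$ is the formula "$f:X\to Y$ is a morphism in ${}^*\mathcal A$ with kernel $g:Z\to X$" in $\widehat{{}^*S}$; and the analogous statement is true for "cokernel", "image" or "coimage" instead of "kernel". (iii) If in addition $\langle\mathcal A,P\rangle$ is abelian, then so is $\langle{}^*\mathcal A,{}^*P\rangle$, and the functor $*:\mathcal A\to{}^*\mathcal A$ is exact.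
   Context: Superstructures: a base set $S$ is an infinite set whose elements are not sets; $S_0=S$, $S_n=S_{n-1}\cup\mathcal P(S_{n-1})$, and $\hat S=\bigcup_{n\ge 0}S_n$. Formulas in $\hat S$ are built from $=$, $\in$, constants in $\hat S$, variables, ordered pairs and function application by $\neg$, $\wedge$ and bounded quantifiers $\forall x\in t$; statements are formulas without free variables. For $\varphi$ a formula in $\hat S$, ${}^*\varphi$ is obtained by replacing each constant $\tau$ by ${}^*\tau$. Enlargement: a map $*:\hat S\to\hat W$ between superstructures with (1) ${}^*S=W$; (2) ${}^*s=s$ for $s\in S$; (3) (transfer) a statement $\varphi$ in $\hat S$ is true iff ${}^*\varphi$ is true; (4) (saturation) with $\mathcal I=\bigcup_{A\in\hat S\setminus S}{}^*A$ (the internal elements), every nonempty family $\{U_i\}_{i\in I}$ of nonempty sets $U_i\in\mathcal I$ with $|I|\le|\hat S|$ and the finite intersection property has nonempty intersection. $\hat S$-small category: a category $\mathcal A=\langle M,s,t,c\rangle$ given by its set of morphisms $M\in\hat S\setminus S$, the maps $s,t:M\to M$ sending a morphism to the identity of its source resp. target, and the composition relation $c=\{\langle f,g,h\rangle: f\circ g=h\}$; objects are identified with their identity morphisms. Its enlargement is the category ${}^*\mathcal A=\langle{}^*M,{}^*s,{}^*t,{}^*c\rangle$, and $*$ induces a functor $*:\mathcal A\to{}^*\mathcal A$. An additive $\hat S$-small category is a pair $\langle\mathcal A,P\rangle$ with $\mathcal A=\langle M,s,t,c\rangle$ $\hat S$-small and $P\subseteq M\times M\times M$ such that for all objects $A,B$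 the intersection of $P$ with $\mathrm{Mor}_{\mathcal A}(A,B)^3$ is (the graph of) an addition map making $\mathrm{Mor}_{\mathcal A}(A,B)$ an abelian group, composition is bilinear, and $\mathcal A$ has a zero object and arbitrary finite sums. It is abelian if it is abelian in the usual sense. *)

theory Defs
  imports "HOL-Algebra.Group" "HOL-Library.Equipollence"
begin

section \<open>Superstructures\<close>

text \<open>
  An ambient extensional membership structure with urelements.  The superstructures over all base sets
  considered live in one such type, so that inclusions such as \<open>S \<subseteq> W\<close> and equations such
  as \<open>*s = s\<close> are literal.  The class only asserts that unordered pairs exist, which makes ordered
  pairs well behaved; the existence of power sets is part of \<open>base_set\<close> below.
\<close>

class urelement_universe =
  fixes atom :: "'a \<Rightarrow> bool"
    and elts :: "'a \<Rightarrow> 'a set"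
  assumes elts_atom: "atom x \<Longrightarrow> elts x = {}"
    and elts_ext: "\<not> atom x \<Longrightarrow> \<not> atom y \<Longrightarrow> elts x = elts y \<Longrightarrow> x = y"
    and ex_upair: "\<exists>y. \<not> atom y \<and> elts y = {a, b}"

definition code :: "'a::urelement_universe set \<Rightarrow> 'a" where
  "code X = (THE y. \<not> atom y \<and> elts y = X)"

fun level :: "'a::urelement_universe set \<Rightarrow> nat \<Rightarrow> 'a set" where
  "level B 0 = B"
| "level B (Suc n) = level B n \<union> {y. \<not> atom y \<and> elts y \<subseteq> level B n}"

definition superstr :: "'a::urelement_universe set \<Rightarrow> 'a set" where
  "superstr B = (\<Union>n. level B n)"

text \<open>
  The third conjunct says that the ambient type contains the full power set of every level, so
  that \<open>level B (Suc n)\<close> really is \<open>level B n \<union> \<P>(level B n)\<close>.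
\<close>

definition base_set :: "'a::urelement_universe set \<Rightarrow> bool" where
  "base_set B \<longleftrightarrow> infinite B \<and> (\<forall>b\<in>B. atom b) \<and>
     (\<forall>n. \<forall>X\<subseteq>level B n. \<exists>y. \<not> atom y \<and> elts y = X)"

definition pair :: "'a::urelement_universe \<Rightarrow> 'a \<Rightarrow> 'a" where
  "pair a b = code {code {a}, code {a, b}}"

definition triple :: "'a::urelement_universe \<Rightarrow> 'a \<Rightarrow> 'a \<Rightarrow> 'a" where
  "triple a b c = pair (pair a b) c"

text \<open>Function application is made total: it is the empty set if there is no unique value.\<close>

definition app :: "'a::urelement_universe \<Rightarrow> 'a \<Rightarrow> 'a" where
  "app f x = (if \<exists>!y. pair x y \<in> elts f then THE y. pair x y \<in> elts f else code {})"

definition is_map :: "'a::urelement_universe \<Rightarrow> 'a \<Rightarrow> 'a \<Rightarrow> bool" where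
  "is_map f D R \<longleftrightarrow> \<not> atom f \<and>
     elts f \<subseteq> {pair x y | x y. x \<in> elts D \<and> y \<in> elts R} \<and>
     (\<forall>x\<in>elts D. \<exists>!y. pair x y \<in> elts f)"

definition is_ternary_rel :: "'a::urelement_universe \<Rightarrow> 'a \<Rightarrow> bool" where
  "is_ternary_rel r D \<longleftrightarrow> \<not> atom r \<and>
     elts r \<subseteq> {triple x y z | x y z. x \<in> elts D \<and> y \<in> elts D \<and> z \<in> elts D}"


section \<open>Formulas\<close>

text \<open>
  \<open>All x t \<phi>\<close> is the bounded quantifier "for all \<open>x \<in> t\<close>"; the variable
  \<open>x\<close> is bound in \<open>\<phi>\<close> but not in \<open>t\<close>.
\<close>

datatype 'a trm = Cst 'a | Var nat | Pr "'a trm" "'a trm" | Ap "'a trm" "'a trm"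

datatype 'a fm =
    Eq "'a trm" "'a trm"
  | In "'a trm" "'a trm"
  | Neg "'a fm"
  | And "'a fm" "'a fm"
  | All nat "'a trm" "'a fm"

primrec fv_trm :: "'a trm \<Rightarrow> nat set" where
  "fv_trm (Cst a) = {}"
| "fv_trm (Var x) = {x}"
| "fv_trm (Pr t u) = fv_trm t \<union> fv_trm u"
| "fv_trm (Ap t u) = fv_trm t \<union> fv_trm u"

primrec fv :: "'a fm \<Rightarrow> nat set" where
  "fv (Eq t u) = fv_trm t \<union> fv_trm u"
| "fv (In t u) = fv_trm t \<union> fv_trm u"
| "fv (Neg \<phi>) = fv \<phi>"
| "fv (And \<phi> \<psi>) = fv \<phi> \<union> fv \<psi>"
| "fv (All x t \<phi>) = fv_trm t \<union> (fv \<phi> - {x})"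

primrec val :: "(nat \<Rightarrow> 'a) \<Rightarrow> 'a::urelement_universe trm \<Rightarrow> 'a" where
  "val e (Cst a) = a"
| "val e (Var x) = e x"
| "val e (Pr t u) = pair (val e t) (val e u)"
| "val e (Ap t u) = app (val e t) (val e u)"

primrec sat :: "(nat \<Rightarrow> 'a) \<Rightarrow> 'a::urelement_universe fm \<Rightarrow> bool" where
  "sat e (Eq t u) \<longleftrightarrow> val e t = val e u"
| "sat e (In t u) \<longleftrightarrow> val e t \<in> elts (val e u)"
| "sat e (Neg \<phi>) \<longleftrightarrow> \<not> sat e \<phi>"
| "sat e (And \<phi> \<psi>) \<longleftrightarrow> sat e \<phi> \<and> sat e \<psi>"
| "sat e (All x t \<phi>) \<longleftrightarrow> (\<forall>a\<in>elts (val e t). sat (e(x := a)) \<phi>)"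

text \<open>\<open>set_fm \<phi>\<close> is the set of constants of \<open>\<phi>\<close>.\<close>

definition formula_in :: "'a::urelement_universe set \<Rightarrow> 'a fm \<Rightarrow> bool" where
  "formula_in B \<phi> \<longleftrightarrow> set_fm \<phi> \<subseteq> superstr B"

definition statement_in :: "'a::urelement_universe set \<Rightarrow> 'a fm \<Rightarrow> bool" where
  "statement_in B \<phi> \<longleftrightarrow> formula_in B \<phi> \<and> fv \<phi> = {}"

definition true_fm :: "'a::urelement_universe fm \<Rightarrow> bool" where
  "true_fm \<phi> \<longleftrightarrow> (\<forall>e. sat e \<phi>)"

abbreviation star_fm :: "('a \<Rightarrow> 'a) \<Rightarrow> 'a fm \<Rightarrow> 'a fm" where
  "star_fm \<equiv> map_fm"


section \<open>Enlargements\<close>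

definition internal :: "'a::urelement_universe set \<Rightarrow> ('a \<Rightarrow> 'a) \<Rightarrow> 'a set" where
  "internal S star = (\<Union>A\<in>superstr S - S. elts (star A))"

text \<open>
  Saturation is stated for sets \<open>F\<close> of internal elements instead of indexed families.
\<close>

definition enlargement ::
  "'a::urelement_universe set \<Rightarrow> 'a set \<Rightarrow> ('a \<Rightarrow> 'a) \<Rightarrow> bool" where
  "enlargement S W star \<longleftrightarrow>
     base_set S \<and> base_set W \<and> star ` superstr S \<subseteq> superstr W \<and>
     star (code S) = code W \<and>
     (\<forall>s\<in>S. star s = s) \<and>
     (\<forall>\<phi>. statement_in S \<phi> \<longrightarrow> true_fm \<phi> = true_fm (star_fm star \<phi>)) \<and>
     (\<forall>F. F \<noteq> {} \<and> F \<subseteq> internal S star \<and> (\<forall>U\<in>F. elts U \<noteq> {}) \<and>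
          F \<lesssim> superstr S \<and>
          (\<forall>G\<subseteq>F. finite G \<and> G \<noteq> {} \<longrightarrow> (\<Inter>U\<in>G. elts U) \<noteq> {})
        \<longrightarrow> (\<Inter>U\<in>F. elts U) \<noteq> {})"


section \<open>Small categories\<close>

record 'a small_cat =
  mor :: 'a
  src :: 'a
  tgt :: 'a
  cmp :: 'a

definition star_cat :: "('a \<Rightarrow> 'a) \<Rightarrow> 'a small_cat \<Rightarrow> 'a small_cat" where
  "star_cat star A =
     \<lparr>mor = star (mor A), src = star (src A), tgt = star (tgt A), cmp = star (cmp A)\<rparr>"

definition Mor :: "'a::urelement_universe small_cat \<Rightarrow> 'a set" where
  "Mor A = elts (mor A)"

definition source :: "'a::urelement_universe small_cat \<Rightarrow> 'a \<Rightarrow> 'a" where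
  "source A f = app (src A) f"

definition target :: "'a::urelement_universe small_cat \<Rightarrow> 'a \<Rightarrow> 'a" where
  "target A f = app (tgt A) f"

definition comp :: "'a::urelement_universe small_cat \<Rightarrow> 'a \<Rightarrow> 'a \<Rightarrow> 'a" where
  "comp A f g = (THE h. triple f g h \<in> elts (cmp A))"

text \<open>Objects are identified with their identity morphisms.\<close>

definition Obj :: "'a::urelement_universe small_cat \<Rightarrow> 'a set" where
  "Obj A = {X \<in> Mor A. source A X = X}"

definition Hom :: "'a::urelement_universe small_cat \<Rightarrow> 'a \<Rightarrow> 'a \<Rightarrow> 'a set" where
  "Hom A X Y = {f \<in> Mor A. source A f = X \<and> target A f = Y}"

definition small_category :: "'a::urelement_universe set \<Rightarrow> 'a small_cat \<Rightarrow> bool" where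
  "small_category B A \<longleftrightarrow>
     mor A \<in> superstr B - B \<and>
     is_map (src A) (mor A) (mor A) \<and> is_map (tgt A) (mor A) (mor A) \<and>
     is_ternary_rel (cmp A) (mor A) \<and>
     (\<forall>f\<in>Mor A. source A (source A f) = source A f \<and> target A (source A f) = source A f \<and>
                source A (target A f) = target A f \<and> target A (target A f) = target A f) \<and>
     (\<forall>f\<in>Mor A. \<forall>g\<in>Mor A.
        (\<exists>h. triple f g h \<in> elts (cmp A)) \<longleftrightarrow> source A f = target A g) \<and>
     (\<forall>f g h h'. triple f g h \<in> elts (cmp A) \<and> triple f g h' \<in> elts (cmp A) \<longrightarrow> h = h') \<and>
     (\<forall>f\<in>Mor A. \<forall>g\<in>Mor A. source A f = target A g \<longrightarrow>
        source A (comp A f g) = source A g \<and> target A (comp A f g) = target A f) \<and>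
     (\<forall>f\<in>Mor A. comp A f (source A f) = f \<and> comp A (target A f) f = f) \<and>
     (\<forall>f\<in>Mor A. \<forall>g\<in>Mor A. \<forall>h\<in>Mor A. source A f = target A g \<and> source A g = target A h \<longrightarrow>
        comp A (comp A f g) h = comp A f (comp A g h))"

definition cat_functor ::
  "'a::urelement_universe small_cat \<Rightarrow> 'a small_cat \<Rightarrow> ('a \<Rightarrow> 'a) \<Rightarrow> bool" where
  "cat_functor A B F \<longleftrightarrow>
     (\<forall>f\<in>Mor A. F f \<in> Mor B \<and> F (source A f) = source B (F f) \<and> F (target A f) = target B (F f)) \<and>
     (\<forall>f\<in>Mor A. \<forall>g\<in>Mor A. source A f = target A g \<longrightarrow> F (comp A f g) = comp B (F f) (F g))"


section \<open>Additive categories\<close>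

text \<open>
  The addition on \<open>Hom A X Y\<close> is read off from \<open>P\<close> restricted to
  \<open>Hom A X Y\<close>; elements of \<open>P\<close> mixing several morphism sets are permitted.
\<close>

definition hom_group ::
  "'a::urelement_universe small_cat \<Rightarrow> 'a \<Rightarrow> 'a \<Rightarrow> 'a \<Rightarrow> 'a monoid" where
  "hom_group A P X Y =
     \<lparr>carrier = Hom A X Y,
      mult = (\<lambda>f g. THE h. h \<in> Hom A X Y \<and> triple f g h \<in> elts P),
      one = (THE z. z \<in> Hom A X Y \<and> (\<forall>f\<in>Hom A X Y. triple z f f \<in> elts P))\<rparr>"

definition add :: "'a::urelement_universe small_cat \<Rightarrow> 'a \<Rightarrow> 'a \<Rightarrow> 'a \<Rightarrow> 'a \<Rightarrow> 'a \<Rightarrow> 'a" where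
  "add A P X Y f g = mult (hom_group A P X Y) f g"

definition zero_mor :: "'a::urelement_universe small_cat \<Rightarrow> 'a \<Rightarrow> 'a \<Rightarrow> 'a \<Rightarrow> 'a" where
  "zero_mor A P X Y = one (hom_group A P X Y)"

definition is_zero_object :: "'a::urelement_universe small_cat \<Rightarrow> 'a \<Rightarrow> bool" where
  "is_zero_object A Z \<longleftrightarrow> Z \<in> Obj A \<and>
     (\<forall>X\<in>Obj A. (\<exists>!f. f \<in> Hom A X Z) \<and> (\<exists>!f. f \<in> Hom A Z X))"

definition is_sum ::
  "'a::urelement_universe small_cat \<Rightarrow> 'a list \<Rightarrow> 'a \<Rightarrow> 'a list \<Rightarrow> bool" where
  "is_sum A Xs C js \<longleftrightarrow>
     C \<in> Obj A \<and> length js = length Xs \<and>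
     (\<forall>i<length Xs. js ! i \<in> Hom A (Xs ! i) C) \<and>
     (\<forall>Y\<in>Obj A. \<forall>fs. length fs = length Xs \<and> (\<forall>i<length Xs. fs ! i \<in> Hom A (Xs ! i) Y) \<longrightarrow>
        (\<exists>!u. u \<in> Hom A C Y \<and> (\<forall>i<length Xs. comp A u (js ! i) = fs ! i)))"

definition additive_category ::
  "'a::urelement_universe set \<Rightarrow> 'a small_cat \<Rightarrow> 'a \<Rightarrow> bool" where
  "additive_category B A P \<longleftrightarrow>
     small_category B A \<and> is_ternary_rel P (mor A) \<and>
     (\<forall>X\<in>Obj A. \<forall>Y\<in>Obj A.
        (\<forall>f\<in>Hom A X Y. \<forall>g\<in>Hom A X Y. \<exists>!h. h \<in> Hom A X Y \<and> triple f g h \<in> elts P) \<and>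
        comm_group (hom_group A P X Y)) \<and>
     (\<forall>X\<in>Obj A. \<forall>Y\<in>Obj A. \<forall>Z\<in>Obj A.
        (\<forall>f\<in>Hom A Y Z. \<forall>g\<in>Hom A X Y. \<forall>g'\<in>Hom A X Y.
           comp A f (add A P X Y g g') = add A P X Z (comp A f g) (comp A f g')) \<and>
        (\<forall>f\<in>Hom A Y Z. \<forall>f'\<in>Hom A Y Z. \<forall>g\<in>Hom A X Y.
           comp A (add A P Y Z f f') g = add A P X Z (comp A f g) (comp A f' g))) \<and>
     (\<exists>Z. is_zero_object A Z) \<and>
     (\<forall>Xs. set Xs \<subseteq> Obj A \<longrightarrow> (\<exists>C js. is_sum A Xs C js))"

definition additive_functor ::
  "'a::urelement_universe small_cat \<Rightarrow> 'a \<Rightarrow> 'a small_cat \<Rightarrow> 'a \<Rightarrow> ('a \<Rightarrow> 'a) \<Rightarrow> bool" where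
  "additive_functor A P B Q F \<longleftrightarrow> cat_functor A B F \<and>
     (\<forall>X\<in>Obj A. \<forall>Y\<in>Obj A. F \<in> hom (hom_group A P X Y) (hom_group B Q (F X) (F Y)))"

text \<open>
  In each of the following four notions the first three object arguments are \<open>X\<close>,
  \<open>Y\<close>, \<open>Z\<close>, where \<open>f : X \<rightarrow> Y\<close> and \<open>Z\<close> is the new object.
\<close>

definition is_kernel ::
  "'a::urelement_universe small_cat \<Rightarrow> 'a \<Rightarrow> 'a \<Rightarrow> 'a \<Rightarrow> 'a \<Rightarrow> 'a \<Rightarrow> 'a \<Rightarrow> bool" where
  "is_kernel A P X Y Z f g \<longleftrightarrow>
     X \<in> Obj A \<and> Y \<in> Obj A \<and> Z \<in> Obj A \<and> f \<in> Hom A X Y \<and> g \<in> Hom A Z X \<and>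
     comp A f g = zero_mor A P Z Y \<and>
     (\<forall>T\<in>Obj A. \<forall>h\<in>Hom A T X. comp A f h = zero_mor A P T Y \<longrightarrow>
        (\<exists>!k. k \<in> Hom A T Z \<and> comp A g k = h))"

definition is_cokernel ::
  "'a::urelement_universe small_cat \<Rightarrow> 'a \<Rightarrow> 'a \<Rightarrow> 'a \<Rightarrow> 'a \<Rightarrow> 'a \<Rightarrow> 'a \<Rightarrow> bool" where
  "is_cokernel A P X Y Z f g \<longleftrightarrow>
     X \<in> Obj A \<and> Y \<in> Obj A \<and> Z \<in> Obj A \<and> f \<in> Hom A X Y \<and> g \<in> Hom A Y Z \<and>
     comp A g f = zero_mor A P X Z \<and>
     (\<forall>T\<in>Obj A. \<forall>h\<in>Hom A Y T. comp A h f = zero_mor A P X T \<longrightarrow>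
        (\<exists>!k. k \<in> Hom A Z T \<and> comp A k g = h))"

text \<open>The image \<open>g : Z \<rightarrow> Y\<close> is the kernel of the cokernel of \<open>f\<close>.\<close>

definition is_image ::
  "'a::urelement_universe small_cat \<Rightarrow> 'a \<Rightarrow> 'a \<Rightarrow> 'a \<Rightarrow> 'a \<Rightarrow> 'a \<Rightarrow> 'a \<Rightarrow> bool" where
  "is_image A P X Y Z f g \<longleftrightarrow>
     (\<exists>C c. is_cokernel A P X Y C f c \<and> is_kernel A P Y C Z c g)"

text \<open>The coimage \<open>g : X \<rightarrow> Z\<close> is the cokernel of the kernel of \<open>f\<close>.\<close>

definition is_coimage ::
  "'a::urelement_universe small_cat \<Rightarrow> 'a \<Rightarrow> 'a \<Rightarrow> 'a \<Rightarrow> 'a \<Rightarrow> 'a \<Rightarrow> 'a \<Rightarrow> bool" where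
  "is_coimage A P X Y Z f g \<longleftrightarrow>
     (\<exists>K k. is_kernel A P X Y K f k \<and> is_cokernel A P K X Z k g)"


section \<open>Abelian categories\<close>

definition is_mono :: "'a::urelement_universe small_cat \<Rightarrow> 'a \<Rightarrow> bool" where
  "is_mono A f \<longleftrightarrow> f \<in> Mor A \<and>
     (\<forall>T\<in>Obj A. \<forall>g\<in>Hom A T (source A f). \<forall>h\<in>Hom A T (source A f).
        comp A f g = comp A f h \<longrightarrow> g = h)"

definition is_epi :: "'a::urelement_universe small_cat \<Rightarrow> 'a \<Rightarrow> bool" where
  "is_epi A f \<longleftrightarrow> f \<in> Mor A \<and>
     (\<forall>T\<in>Obj A. \<forall>g\<in>Hom A (target A f) T. \<forall>h\<in>Hom A (target A f) T.
        comp A g f = comp A h f \<longrightarrow> g = h)"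

definition abelian_category ::
  "'a::urelement_universe set \<Rightarrow> 'a small_cat \<Rightarrow> 'a \<Rightarrow> bool" where
  "abelian_category B A P \<longleftrightarrow> additive_category B A P \<and>
     (\<forall>X\<in>Obj A. \<forall>Y\<in>Obj A. \<forall>f\<in>Hom A X Y.
        (\<exists>Z g. is_kernel A P X Y Z f g) \<and> (\<exists>Z g. is_cokernel A P X Y Z f g)) \<and>
     (\<forall>g. is_mono A g \<longrightarrow> (\<exists>Y f. is_kernel A P (target A g) Y (source A g) f g)) \<and>
     (\<forall>g. is_epi A g \<longrightarrow> (\<exists>X f. is_cokernel A P X (source A g) (target A g) f g))"

text \<open>Exactness of \<open>X \<rightarrow> Y \<rightarrow> Z\<close> at \<open>Y\<close>: the image of \<open>f\<close> is the kernel of \<open>g\<close>.\<close>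

definition exact_seq ::
  "'a::urelement_universe small_cat \<Rightarrow> 'a \<Rightarrow> 'a \<Rightarrow> 'a \<Rightarrow> 'a \<Rightarrow> 'a \<Rightarrow> 'a \<Rightarrow> bool" where
  "exact_seq A P X Y Z f g \<longleftrightarrow>
     (\<exists>I i. is_image A P X Y I f i \<and> is_kernel A P Y Z I g i)"

definition exact_functor ::
  "'a::urelement_universe small_cat \<Rightarrow> 'a \<Rightarrow> 'a small_cat \<Rightarrow> 'a \<Rightarrow> ('a \<Rightarrow> 'a) \<Rightarrow> bool" where
  "exact_functor A P B Q F \<longleftrightarrow> additive_functor A P B Q F \<and>
     (\<forall>X Y Z f g. exact_seq A P X Y Z f g \<longrightarrow> exact_seq B Q (F X) (F Y) (F Z) (F f) (F g))"


section \<open>The formulas for kernels, cokernels, images and coimages\<close>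

definition Imp :: "'a fm \<Rightarrow> 'a fm \<Rightarrow> 'a fm" where
  "Imp \<phi> \<psi> = Neg (And \<phi> (Neg \<psi>))"

definition Exi :: "nat \<Rightarrow> 'a trm \<Rightarrow> 'a fm \<Rightarrow> 'a fm" where
  "Exi x t \<phi> = Neg (All x t (Neg \<phi>))"

definition obj_fm :: "'a small_cat \<Rightarrow> nat \<Rightarrow> 'a fm" where
  "obj_fm A X = And (In (Var X) (Cst (mor A))) (Eq (Ap (Cst (src A)) (Var X)) (Var X))"

definition hom_fm :: "'a small_cat \<Rightarrow> nat \<Rightarrow> nat \<Rightarrow> nat \<Rightarrow> 'a fm" where
  "hom_fm A f X Y = And (In (Var f) (Cst (mor A)))
     (And (Eq (Ap (Cst (src A)) (Var f)) (Var X)) (Eq (Ap (Cst (tgt A)) (Var f)) (Var Y)))"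

definition comp_fm :: "'a small_cat \<Rightarrow> nat \<Rightarrow> nat \<Rightarrow> nat \<Rightarrow> 'a fm" where
  "comp_fm A f g h = In (Pr (Pr (Var f) (Var g)) (Var h)) (Cst (cmp A))"

text \<open>
  Bound variables are chosen fixed.  The variable arguments have to be different from 10 and 11 in
  \<open>comp_zero_fm\<close>, less than 10 in \<open>kernel_fm\<close> and \<open>cokernel_fm\<close>, and less than 5 in
  \<open>image_fm\<close> and \<open>coimage_fm\<close>.
\<close>

text \<open>\<open>f \<circ> g = 0\<close> in \<open>Hom(X, Y)\<close>\<close>

definition comp_zero_fm :: "'a small_cat \<Rightarrow> 'a \<Rightarrow> nat \<Rightarrow> nat \<Rightarrow> nat \<Rightarrow> nat \<Rightarrow> 'a fm" where
  "comp_zero_fm A P f g X Y =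
     Exi 10 (Cst (mor A)) (And (And (comp_fm A f g 10) (hom_fm A 10 X Y))
       (All 11 (Cst (mor A)) (Imp (hom_fm A 11 X Y)
          (In (Pr (Pr (Var 10) (Var 11)) (Var 11)) (Cst P)))))"

definition kernel_fm ::
  "'a small_cat \<Rightarrow> 'a \<Rightarrow> nat \<Rightarrow> nat \<Rightarrow> nat \<Rightarrow> nat \<Rightarrow> nat \<Rightarrow> 'a fm" where
  "kernel_fm A P X Y Z f g =
     And (And (obj_fm A X) (And (obj_fm A Y) (obj_fm A Z)))
    (And (And (hom_fm A f X Y) (hom_fm A g Z X))
    (And (comp_zero_fm A P f g Z Y)
    (All 14 (Cst (mor A)) (Imp (obj_fm A 14)
    (All 15 (Cst (mor A)) (Imp (And (hom_fm A 15 14 X) (comp_zero_fm A P f 15 14 Y))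
       (Exi 12 (Cst (mor A)) (And (And (hom_fm A 12 14 Z) (comp_fm A g 12 15))
          (All 13 (Cst (mor A)) (Imp (And (hom_fm A 13 14 Z) (comp_fm A g 13 15))
             (Eq (Var 13) (Var 12))))))))))))"

definition cokernel_fm ::
  "'a small_cat \<Rightarrow> 'a \<Rightarrow> nat \<Rightarrow> nat \<Rightarrow> nat \<Rightarrow> nat \<Rightarrow> nat \<Rightarrow> 'a fm" where
  "cokernel_fm A P X Y Z f g =
     And (And (obj_fm A X) (And (obj_fm A Y) (obj_fm A Z)))
    (And (And (hom_fm A f X Y) (hom_fm A g Y Z))
    (And (comp_zero_fm A P g f X Z)
    (All 14 (Cst (mor A)) (Imp (obj_fm A 14)
    (All 15 (Cst (mor A)) (Imp (And (hom_fm A 15 Y 14) (comp_zero_fm A P 15 f X 14))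
       (Exi 12 (Cst (mor A)) (And (And (hom_fm A 12 Z 14) (comp_fm A 12 g 15))
          (All 13 (Cst (mor A)) (Imp (And (hom_fm A 13 Z 14) (comp_fm A 13 g 15))
             (Eq (Var 13) (Var 12))))))))))))"

definition image_fm ::
  "'a small_cat \<Rightarrow> 'a \<Rightarrow> nat \<Rightarrow> nat \<Rightarrow> nat \<Rightarrow> nat \<Rightarrow> nat \<Rightarrow> 'a fm" where
  "image_fm A P X Y Z f g =
     Exi 5 (Cst (mor A)) (Exi 6 (Cst (mor A))
       (And (cokernel_fm A P X Y 5 f 6) (kernel_fm A P Y 5 Z 6 g)))"

definition coimage_fm ::
  "'a small_cat \<Rightarrow> 'a \<Rightarrow> nat \<Rightarrow> nat \<Rightarrow> nat \<Rightarrow> nat \<Rightarrow> nat \<Rightarrow> 'a fm" where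
  "coimage_fm A P X Y Z f g =
     Exi 5 (Cst (mor A)) (Exi 6 (Cst (mor A))
       (And (kernel_fm A P X Y 5 f 6) (cokernel_fm A P 5 X Z 6 g)))"

text \<open>
  \<open>\<phi>[X, Y, Z, f, g]\<close>, with free variables numbered 0 to 4 in this order, is a formula in the
  superstructure over \<open>B\<close> saying \<open>R X Y Z f g\<close> for parameters from \<open>D\<close>.
\<close>

definition expresses ::
  "'a::urelement_universe set \<Rightarrow> 'a set \<Rightarrow> 'a fm \<Rightarrow> ('a \<Rightarrow> 'a \<Rightarrow> 'a \<Rightarrow> 'a \<Rightarrow> 'a \<Rightarrow> bool) \<Rightarrow> bool"
  where
  "expresses B D \<phi> R \<longleftrightarrow> formula_in B \<phi> \<and> fv \<phi> \<subseteq> {..<5} \<and>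
     (\<forall>X\<in>D. \<forall>Y\<in>D. \<forall>Z\<in>D. \<forall>f\<in>D. \<forall>g\<in>D.
        sat ((!) [X, Y, Z, f, g]) \<phi> \<longleftrightarrow> R X Y Z f g)"

end

theory Submission
  imports Defs
begin

text \<open>
  Each axiom of an additive or abelian category quantifies only over morphisms, with one exception:
  the existence of sums of arbitrary finite families. In the presence of a zero object those follow
  from binary sums by induction (\<open>finite_sums\<close>). Hence, for a set of morphisms and relations in the
  superstructure over \<open>B\<close>, being an additive category, and then being abelian, amounts to
  satisfying a single closed bounded formula, uniformly in \<open>B\<close> and in the data: see
  \<open>additive_category_iff_sat\<close> and \<open>abelian_category_iff_sat\<close>. The functional notions
  \<open>comp\<close>, \<open>add\<close> and \<open>zero_mor\<close>, which are defined by description, enter these formulas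
  through their graphs (\<open>triple_comp_iff\<close>, \<open>triple_add_iff\<close>, \<open>zero_mor_iff\<close>).
  Applying \<open>*\<close> to such a formula merely replaces the data by their images, so transfer turns
  the formula for \<open>\<langle>A, P\<rangle>\<close> into the one for \<open>\<langle>*A, *P\<rangle>\<close>.

  Transfer is assumed for closed formulas only; naming the values of the free variables by constants
  extends it to formulas with parameters from the superstructure (\<open>transfer_sat\<close>). For atomic
  formulas this gives the functoriality and additivity of \<open>*\<close>. The kernel and cokernel formulas
  say what they should in every additive category, hence on both sides of \<open>*\<close>; so \<open>*\<close>
  preserves kernels and cokernels, and with them images and exact sequences. Finally, if two
  formulas define the same relation on the superstructure over \<open>S\<close>, then their equivalence on
  members of five given sets is a closed formula; transferring it shows that their images define the
  same relation on internal elements (\<open>expresses_star\<close>).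
\<close>

section \<open>Sets and ordered pairs in a superstructure\<close>

lemma code_eq:
  assumes "\<not> atom y" "elts y = X"
  shows "code X = y"
  unfolding code_def
proof (rule the_equality)
  fix z assume "\<not> atom z \<and> elts z = X"
  then show "z = y" by (intro elts_ext) (simp_all add: assms)
qed (simp add: assms)

lemma code_upair: "\<not> atom (code {a, b}) \<and> elts (code {a, b}) = {a, b}"
proof -
  obtain y where y: "\<not> atom y" "elts y = {a, b}" using ex_upair by blast
  then show ?thesis using code_eq[OF y] by simp
qed

lemma code_singleton: "\<not> atom (code {a}) \<and> elts (code {a}) = {a}"
  using code_upair[of a a] by simp

lemma pair_inject [simp]: "pair a b = pair c d \<longleftrightarrow> a = c \<and> b = d"
proof
  assume "pair a b = pair c d"
  then have "elts ` elts (pair a b) = elts ` elts (pair c d)" by (rule arg_cong)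
  then have "{{a}, {a, b}} = {{c}, {c, d}}"
    by (simp only: pair_def code_upair code_singleton image_insert image_empty)
  then show "a = c \<and> b = d" by (metis doubleton_eq_iff insert_absorb2)
qed simp

lemma triple_inject [simp]: "triple a b c = triple a' b' c' \<longleftrightarrow> a = a' \<and> b = b' \<and> c = c'"
  by (simp add: triple_def)

lemma level_mono: "m \<le> n \<Longrightarrow> level B m \<subseteq> level B n"
  by (rule lift_Suc_mono_le[of "level B"]) auto

lemma level_subset_superstr: "level B n \<subseteq> superstr B"
  by (auto simp: superstr_def)

lemma level_cases:
  assumes "x \<in> level B n"
  shows "x \<in> B \<or> (\<not> atom x \<and> elts x \<subseteq> level B n)"
  using assms
proof (induction n)
  case (Suc n)
  then show ?case using level_mono[of n "Suc n" B] by auto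
qed simp

lemma base_set_atom: "base_set B \<Longrightarrow> b \<in> B \<Longrightarrow> atom b"
  by (simp add: base_set_def)

lemma elts_subset_level:
  assumes "base_set B" "x \<in> superstr B"
  obtains n where "elts x \<subseteq> level B n"
proof -
  obtain n where "x \<in> level B n" using assms by (auto simp: superstr_def)
  then have "elts x \<subseteq> level B n"
    using level_cases[of x B n] base_set_atom[OF assms(1), of x] elts_atom[of x] by auto
  then show thesis by (rule that)
qed

lemma superstr_elts:
  assumes "base_set B" "x \<in> superstr B" "y \<in> elts x"
  shows "y \<in> superstr B"
proof -
  obtain n where "elts x \<subseteq> level B n" by (rule elts_subset_level[OF assms(1,2)])
  then show ?thesis using assms(3) level_subset_superstr by blast
qed

lemma mem_superstr_minus_base_iff:
  assumes "base_set B"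
  shows "x \<in> superstr B - B \<longleftrightarrow> \<not> atom x \<and> (\<exists>n. elts x \<subseteq> level B n)"
proof
  assume x: "x \<in> superstr B - B"
  then obtain n where "x \<in> level B n" by (auto simp: superstr_def)
  then show "\<not> atom x \<and> (\<exists>n. elts x \<subseteq> level B n)" using level_cases[of x B n] x by auto
next
  assume x: "\<not> atom x \<and> (\<exists>n. elts x \<subseteq> level B n)"
  then obtain n where "elts x \<subseteq> level B n" by auto
  with x have "x \<in> level B (Suc n)" by simp
  then show "x \<in> superstr B - B"
    using x base_set_atom[OF assms, of x] level_subset_superstr[of B "Suc n"] by blast
qed

lemma pair_in_level:
  assumes "a \<in> level B n" "b \<in> level B n"
  shows "pair a b \<in> level B (Suc (Suc n))"
proof -
  have "code {a} \<in> level B (Suc n)" "code {a, b} \<in> level B (Suc n)"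
    using assms by (auto simp: code_upair code_singleton)
  then show ?thesis unfolding pair_def level.simps(2)[of B "Suc n"] by (simp add: code_upair del: level.simps)
qed

lemma is_map_in_superstr:
  assumes B: "base_set B" and M: "M \<in> superstr B" and f: "is_map f M M"
  shows "f \<in> superstr B - B"
proof -
  obtain n where n: "elts M \<subseteq> level B n" by (rule elts_subset_level[OF B M])
  have "elts f \<subseteq> {pair x y |x y. x \<in> elts M \<and> y \<in> elts M}" using f by (simp add: is_map_def)
  then have "elts f \<subseteq> level B (Suc (Suc n))" using n pair_in_level[of _ B n] by blast
  moreover have "\<not> atom f" using f by (simp add: is_map_def)
  ultimately show ?thesis unfolding mem_superstr_minus_base_iff[OF B] by blast
qed

lemma ternary_rel_in_superstr:
  assumes B: "base_set B" and M: "M \<in> superstr B" and r: "is_ternary_rel r M"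
  shows "r \<in> superstr B - B"
proof -
  obtain n where n: "elts M \<subseteq> level B n" by (rule elts_subset_level[OF B M])
  have tr: "triple x y z \<in> level B (Suc (Suc (Suc (Suc n))))"
    if "x \<in> elts M" "y \<in> elts M" "z \<in> elts M" for x y z
    unfolding triple_def
    by (rule pair_in_level, rule pair_in_level) (use that n level_mono[of n "Suc (Suc n)" B] in auto)
  have "elts r \<subseteq> {triple x y z |x y z. x \<in> elts M \<and> y \<in> elts M \<and> z \<in> elts M}"
    using r by (simp add: is_ternary_rel_def)
  then have "elts r \<subseteq> level B (Suc (Suc (Suc (Suc n))))" using tr by blast
  moreover have "\<not> atom r" using r by (simp add: is_ternary_rel_def)
  ultimately show ?thesis unfolding mem_superstr_minus_base_iff[OF B] by blast
qed

lemma code_base_set: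
  assumes "base_set B"
  shows "elts (code B) = B" "code B \<in> superstr B"
proof -
  have "B \<subseteq> level B 0" by simp
  then obtain y where y: "\<not> atom y" "elts y = B" using assms unfolding base_set_def by blast
  then have "code B = y" by (rule code_eq)
  moreover have "elts y \<subseteq> level B 0" using y by simp
  ultimately show "elts (code B) = B" "code B \<in> superstr B"
    using y mem_superstr_minus_base_iff[OF assms, of y] by blast+
qed


section \<open>Transfer for formulas with parameters\<close>

lemma val_cong: "(\<And>x. x \<in> fv_trm t \<Longrightarrow> e x = e' x) \<Longrightarrow> val e t = val e' t"
  by (induction t) auto

lemma sat_cong: "(\<And>x. x \<in> fv \<phi> \<Longrightarrow> e x = e' x) \<Longrightarrow> sat e \<phi> \<longleftrightarrow> sat e' \<phi>"
proof (induction \<phi> arbitrary: e e')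
  case (Eq t u)
  then show ?case using val_cong[of t e e'] val_cong[of u e e'] by simp
next
  case (In t u)
  then show ?case using val_cong[of t e e'] val_cong[of u e e'] by simp
next
  case (And \<phi> \<psi>)
  have "sat e \<phi> \<longleftrightarrow> sat e' \<phi>" by (rule And.IH(1)) (use And.prems in simp)
  moreover have "sat e \<psi> \<longleftrightarrow> sat e' \<psi>" by (rule And.IH(2)) (use And.prems in simp)
  ultimately show ?case by simp
next
  case (All x t \<phi>)
  have "val e t = val e' t" using All.prems by (intro val_cong) auto
  moreover have "sat (e(x := a)) \<phi> \<longleftrightarrow> sat (e'(x := a)) \<phi>" for a
    by (rule All.IH) (use All.prems in auto)
  ultimately show ?case by simp
next
  case (Neg \<phi>)
  have "sat e \<phi> \<longleftrightarrow> sat e' \<phi>" by (rule Neg.IH) (use Neg.prems in simp)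
  then show ?case by simp
qed

lemma true_fm_iff_sat:
  assumes "fv \<phi> = {}"
  shows "true_fm \<phi> \<longleftrightarrow> sat e \<phi>"
proof -
  have "sat e' \<phi> \<longleftrightarrow> sat e \<phi>" for e' by (rule sat_cong) (simp add: assms)
  then show ?thesis unfolding true_fm_def by blast
qed

lemma fv_star_trm [simp]: "fv_trm (map_trm h t) = fv_trm t"
  by (induction t) auto

lemma fv_star_fm [simp]: "fv (star_fm h \<phi>) = fv \<phi>"
  by (induction \<phi>) auto

text \<open>Replacement of the free variables in \<open>V\<close> by constants naming their values under \<open>e\<close>.\<close>

primrec inst_trm :: "(nat \<Rightarrow> 'a) \<Rightarrow> nat set \<Rightarrow> 'a trm \<Rightarrow> 'a trm" where
  "inst_trm e V (Cst a) = Cst a"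
| "inst_trm e V (Var x) = (if x \<in> V then Cst (e x) else Var x)"
| "inst_trm e V (Pr t u) = Pr (inst_trm e V t) (inst_trm e V u)"
| "inst_trm e V (Ap t u) = Ap (inst_trm e V t) (inst_trm e V u)"

primrec inst_fm :: "(nat \<Rightarrow> 'a) \<Rightarrow> nat set \<Rightarrow> 'a fm \<Rightarrow> 'a fm" where
  "inst_fm e V (Eq t u) = Eq (inst_trm e V t) (inst_trm e V u)"
| "inst_fm e V (In t u) = In (inst_trm e V t) (inst_trm e V u)"
| "inst_fm e V (Neg \<phi>) = Neg (inst_fm e V \<phi>)"
| "inst_fm e V (And \<phi> \<psi>) = And (inst_fm e V \<phi>) (inst_fm e V \<psi>)"
| "inst_fm e V (All x t \<phi>) = All x (inst_trm e V t) (inst_fm e (V - {x}) \<phi>)"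

lemma val_inst_trm: "val e' (inst_trm e V t) = val (\<lambda>x. if x \<in> V then e x else e' x) t"
  by (induction t) auto

lemma sat_inst_fm: "sat e' (inst_fm e V \<phi>) \<longleftrightarrow> sat (\<lambda>x. if x \<in> V then e x else e' x) \<phi>"
proof (induction \<phi> arbitrary: e' V)
  case (All x t \<phi>)
  have "(\<lambda>y. if y \<in> V - {x} then e y else (e'(x := a)) y) =
      (\<lambda>y. if y \<in> V then e y else e' y)(x := a)" for a
    by auto
  then show ?case by (simp add: val_inst_trm All.IH)
qed (auto simp: val_inst_trm)

lemma fv_inst_trm: "fv_trm (inst_trm e V t) = fv_trm t - V"
  by (induction t) auto

lemma fv_inst_fm: "fv (inst_fm e V \<phi>) = fv \<phi> - V"
  by (induction \<phi> arbitrary: V) (auto simp: fv_inst_trm)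

lemma set_inst_trm: "set_trm (inst_trm e V t) \<subseteq> set_trm t \<union> e ` V"
  by (induction t) auto

lemma set_inst_fm: "set_fm (inst_fm e V \<phi>) \<subseteq> set_fm \<phi> \<union> e ` V"
proof (induction \<phi> arbitrary: V)
  case (All x t \<phi>)
  show ?case using set_inst_trm[of e V t] All.IH[of "V - {x}"] by auto
next
  case (And \<phi> \<psi>)
  show ?case using And.IH(1)[of V] And.IH(2)[of V] by auto
qed (use set_inst_trm in fastforce)+

lemma star_inst_trm: "map_trm h (inst_trm e V t) = inst_trm (h \<circ> e) V (map_trm h t)"
  by (induction t) auto

lemma star_inst_fm: "star_fm h (inst_fm e V \<phi>) = inst_fm (h \<circ> e) V (star_fm h \<phi>)"
  by (induction \<phi> arbitrary: V) (auto simp: star_inst_trm)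

lemma transfer_sat:
  assumes enl: "enlargement S W star" and \<phi>: "formula_in S \<phi>"
    and e: "\<And>x. x \<in> fv \<phi> \<Longrightarrow> e x \<in> superstr S"
  shows "sat e \<phi> \<longleftrightarrow> sat (star \<circ> e) (star_fm star \<phi>)"
proof -
  let ?\<psi> = "inst_fm e (fv \<phi>) \<phi>"
  have "set_fm ?\<psi> \<subseteq> superstr S"
    using set_inst_fm[of e "fv \<phi>" \<phi>] \<phi> e by (auto simp: formula_in_def)
  then have "statement_in S ?\<psi>" by (simp add: statement_in_def formula_in_def fv_inst_fm)
  then have "true_fm ?\<psi> \<longleftrightarrow> true_fm (star_fm star ?\<psi>)"
    using enl by (simp add: enlargement_def)
  then have "sat e ?\<psi> \<longleftrightarrow> sat (star \<circ> e) (star_fm star ?\<psi>)"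
    by (subst (asm) (1 2) true_fm_iff_sat) (auto simp: fv_inst_fm)
  moreover have "sat e ?\<psi> \<longleftrightarrow> sat e \<phi>" by (simp add: sat_inst_fm)
  moreover have "sat (star \<circ> e) (star_fm star ?\<psi>) \<longleftrightarrow> sat (star \<circ> e) (star_fm star \<phi>)"
    unfolding star_inst_fm sat_inst_fm by (rule sat_cong) simp
  ultimately show ?thesis by blast
qed

lemma transfer_closed:
  assumes "enlargement S W star" "formula_in S \<phi>" "fv \<phi> = {}"
  shows "sat e \<phi> \<longleftrightarrow> sat e' (star_fm star \<phi>)"
  using transfer_sat[OF assms(1,2), of e] assms(3)
    sat_cong[of "star_fm star \<phi>" "star \<circ> e" e'] by simp

lemma enlargement_base_sets: "enlargement S W star \<Longrightarrow> base_set S \<and> base_set W"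
  by (simp add: enlargement_def)

lemma star_in_superstr: "enlargement S W star \<Longrightarrow> x \<in> superstr S \<Longrightarrow> star x \<in> superstr W"
  by (auto simp: enlargement_def)

lemma formula_in_star_fm:
  "enlargement S W star \<Longrightarrow> formula_in S \<phi> \<Longrightarrow> formula_in W (star_fm star \<phi>)"
  by (auto simp: formula_in_def fm.set_map star_in_superstr)

lemma star_mem_iff:
  assumes "enlargement S W star" "x \<in> superstr S" "y \<in> superstr S"
  shows "star x \<in> elts (star y) \<longleftrightarrow> x \<in> elts y"
  using transfer_closed[OF assms(1), of "In (Cst x) (Cst y)"] assms by (simp add: formula_in_def)

lemma star_app:
  assumes "enlargement S W star" "f \<in> superstr S" "x \<in> superstr S" "app f x \<in> superstr S"
  shows "star (app f x) = app (star f) (star x)"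
  using transfer_closed[OF assms(1), of "Eq (Cst (app f x)) (Ap (Cst f) (Cst x))"] assms
  by (simp add: formula_in_def)

lemma star_triple_mem:
  assumes "enlargement S W star"
    and "x \<in> superstr S" "y \<in> superstr S" "z \<in> superstr S" "r \<in> superstr S"
    and "triple x y z \<in> elts r"
  shows "triple (star x) (star y) (star z) \<in> elts (star r)"
  using transfer_closed[OF assms(1), of "In (Pr (Pr (Cst x) (Cst y)) (Cst z)) (Cst r)"] assms
  by (simp add: formula_in_def triple_def)

lemma star_in_superstr_minus_base:
  assumes enl: "enlargement S W star" and x: "x \<in> superstr S - S"
  shows "star x \<in> superstr W - W"
proof -
  have B: "base_set S" "base_set W" and "star (code S) = code W"
    using enl by (simp_all add: enlargement_def)
  then have "star x \<notin> W"
    using star_mem_iff[OF enl, of x "code S"] x code_base_set[OF B(1)] code_base_set[OF B(2)] by simp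
  with enl x show ?thesis by (simp add: star_in_superstr)
qed


section \<open>Formulas about a small category\<close>

text \<open>
  Quantifiers over the objects of \<open>A\<close> (\<open>AllO\<close>, \<open>ExO\<close>) and over the morphisms from
  \<open>X\<close> to \<open>Y\<close> (\<open>AllH\<close>, \<open>ExH\<close>), bounded by the set of all morphisms. For the latter the
  bound variable has to differ from the variables \<open>X\<close> and \<open>Y\<close>.
\<close>

definition AllO :: "'a small_cat \<Rightarrow> nat \<Rightarrow> 'a fm \<Rightarrow> 'a fm" where
  "AllO A X \<phi> = All X (Cst (mor A)) (Imp (obj_fm A X) \<phi>)"

definition ExO :: "'a small_cat \<Rightarrow> nat \<Rightarrow> 'a fm \<Rightarrow> 'a fm" where
  "ExO A X \<phi> = Exi X (Cst (mor A)) (And (obj_fm A X) \<phi>)"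

definition AllH :: "'a small_cat \<Rightarrow> nat \<Rightarrow> nat \<Rightarrow> nat \<Rightarrow> 'a fm \<Rightarrow> 'a fm" where
  "AllH A f X Y \<phi> = All f (Cst (mor A)) (Imp (hom_fm A f X Y) \<phi>)"

definition ExH :: "'a small_cat \<Rightarrow> nat \<Rightarrow> nat \<Rightarrow> nat \<Rightarrow> 'a fm \<Rightarrow> 'a fm" where
  "ExH A f X Y \<phi> = Exi f (Cst (mor A)) (And (hom_fm A f X Y) \<phi>)"

text \<open>\<open>f + g = h\<close>\<close>

definition add_fm :: "'a \<Rightarrow> nat \<Rightarrow> nat \<Rightarrow> nat \<Rightarrow> 'a fm" where
  "add_fm P f g h = In (Pr (Pr (Var f) (Var g)) (Var h)) (Cst P)"

lemma sat_Imp [simp]: "sat e (Imp \<phi> \<psi>) \<longleftrightarrow> (sat e \<phi> \<longrightarrow> sat e \<psi>)"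
  by (simp add: Imp_def)

lemma sat_Exi [simp]: "sat e (Exi x t \<phi>) \<longleftrightarrow> (\<exists>a\<in>elts (val e t). sat (e(x := a)) \<phi>)"
  by (simp add: Exi_def)

lemma sat_obj_fm [simp]: "sat e (obj_fm A X) \<longleftrightarrow> e X \<in> Obj A"
  by (simp add: obj_fm_def Obj_def Mor_def source_def)

lemma sat_hom_fm [simp]: "sat e (hom_fm A f X Y) \<longleftrightarrow> e f \<in> Hom A (e X) (e Y)"
  by (simp add: hom_fm_def Hom_def Mor_def source_def target_def)

lemma sat_comp_fm [simp]: "sat e (comp_fm A f g h) \<longleftrightarrow> triple (e f) (e g) (e h) \<in> elts (cmp A)"
  by (simp add: comp_fm_def triple_def)

lemma sat_add_fm [simp]: "sat e (add_fm P f g h) \<longleftrightarrow> triple (e f) (e g) (e h) \<in> elts P"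
  by (simp add: add_fm_def triple_def)

lemma Obj_imp_Mor: "X \<in> Obj A \<Longrightarrow> X \<in> elts (mor A)"
  by (simp add: Obj_def Mor_def)

lemma Hom_imp_Mor: "f \<in> Hom A X Y \<Longrightarrow> f \<in> elts (mor A)"
  by (simp add: Hom_def Mor_def)

lemma sat_AllO [simp]: "sat e (AllO A X \<phi>) \<longleftrightarrow> (\<forall>a\<in>Obj A. sat (e(X := a)) \<phi>)"
  by (auto simp: AllO_def dest: Obj_imp_Mor)

lemma sat_ExO [simp]: "sat e (ExO A X \<phi>) \<longleftrightarrow> (\<exists>a\<in>Obj A. sat (e(X := a)) \<phi>)"
  by (auto simp: ExO_def dest: Obj_imp_Mor)

lemma sat_AllH [simp]:
  "f \<noteq> X \<Longrightarrow> f \<noteq> Y \<Longrightarrow> sat e (AllH A f X Y \<phi>) \<longleftrightarrow> (\<forall>a\<in>Hom A (e X) (e Y). sat (e(f := a)) \<phi>)"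
  by (auto simp: AllH_def dest: Hom_imp_Mor)

lemma sat_ExH [simp]:
  "f \<noteq> X \<Longrightarrow> f \<noteq> Y \<Longrightarrow> sat e (ExH A f X Y \<phi>) \<longleftrightarrow> (\<exists>a\<in>Hom A (e X) (e Y). sat (e(f := a)) \<phi>)"
  by (auto simp: ExH_def dest: Hom_imp_Mor)

lemmas fm_builder_defs = Imp_def Exi_def obj_fm_def hom_fm_def comp_fm_def add_fm_def
  AllO_def ExO_def AllH_def ExH_def

lemma ex1_iff_bex: "(\<exists>!x. x \<in> H) \<longleftrightarrow> (\<exists>x\<in>H. \<forall>y\<in>H. y = x)"
  by (auto simp: Ex1_def)

lemma ex1_conj_iff_bex:
  "(\<exists>!x. x \<in> H \<and> Q x) \<longleftrightarrow> (\<exists>x\<in>H. Q x \<and> (\<forall>y\<in>H. Q y \<longrightarrow> y = x))"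
  by (auto simp: Ex1_def)


section \<open>Small categories as first-order structures\<close>

lemma app_mem:
  assumes "is_map f D R" "x \<in> elts D"
  shows "app f x \<in> elts R"
proof -
  have ex: "\<exists>!y. pair x y \<in> elts f" using assms by (simp add: is_map_def)
  then have "pair x (app f x) \<in> elts f" using theI'[OF ex] by (simp add: app_def)
  then show ?thesis using assms by (fastforce simp: is_map_def)
qed

text \<open>The formulas for maps and ternary relations leave out that these are sets, not atoms.\<close>

definition is_map_fm :: "'a \<Rightarrow> 'a \<Rightarrow> 'a fm" where
  "is_map_fm f M = And
     (All 0 (Cst f) (Exi 1 (Cst M) (Exi 2 (Cst M) (Eq (Var 0) (Pr (Var 1) (Var 2))))))
     (All 0 (Cst M) (Exi 1 (Cst M) (And (In (Pr (Var 0) (Var 1)) (Cst f))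
        (All 2 (Cst M) (Imp (In (Pr (Var 0) (Var 2)) (Cst f)) (Eq (Var 2) (Var 1)))))))"

lemma is_map_iff_sat: "is_map f M M \<longleftrightarrow> \<not> atom f \<and> sat e (is_map_fm f M)"
proof -
  have "(\<forall>x\<in>elts M. \<exists>!y. pair x y \<in> elts f) \<longleftrightarrow>
      (\<forall>x\<in>elts M. \<exists>y\<in>elts M. pair x y \<in> elts f \<and> (\<forall>z\<in>elts M. pair x z \<in> elts f \<longrightarrow> z = y))"
    if "elts f \<subseteq> {pair x y |x y. x \<in> elts M \<and> y \<in> elts M}"
  proof -
    have "y \<in> elts M" if "pair x y \<in> elts f" for x y
      using that \<open>elts f \<subseteq> _\<close> by fastforce
    then show ?thesis by blast
  qed
  moreover have "elts f \<subseteq> {pair x y |x y. x \<in> elts M \<and> y \<in> elts M} \<longleftrightarrow>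
      (\<forall>p\<in>elts f. \<exists>x\<in>elts M. \<exists>y\<in>elts M. p = pair x y)"
    by blast
  ultimately show ?thesis unfolding is_map_def is_map_fm_def by auto
qed

definition ternary_rel_fm :: "'a \<Rightarrow> 'a \<Rightarrow> 'a fm" where
  "ternary_rel_fm r M = All 0 (Cst r) (Exi 1 (Cst M) (Exi 2 (Cst M) (Exi 3 (Cst M)
     (Eq (Var 0) (Pr (Pr (Var 1) (Var 2)) (Var 3))))))"

lemma is_ternary_rel_iff_sat: "is_ternary_rel r M \<longleftrightarrow> \<not> atom r \<and> sat e (ternary_rel_fm r M)"
proof -
  have "elts r \<subseteq> {triple x y z |x y z. x \<in> elts M \<and> y \<in> elts M \<and> z \<in> elts M} \<longleftrightarrow>
      (\<forall>p\<in>elts r. \<exists>x\<in>elts M. \<exists>y\<in>elts M. \<exists>z\<in>elts M. p = triple x y z)"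
    by blast
  then show ?thesis unfolding is_ternary_rel_def ternary_rel_fm_def by (simp add: triple_def)
qed

lemma is_ternary_rel_mem:
  "is_ternary_rel r M \<Longrightarrow> triple x y z \<in> elts r \<Longrightarrow> x \<in> elts M \<and> y \<in> elts M \<and> z \<in> elts M"
  unfolding is_ternary_rel_def by fastforce

text \<open>
  The axioms of a small category on sources and targets and on composition being a partial function
  with the right domain. Once they hold, \<open>cmp A\<close> is the graph of \<open>comp A\<close>.
\<close>

definition composition_graph :: "'a::urelement_universe small_cat \<Rightarrow> bool" where
  "composition_graph A \<longleftrightarrow>
     is_map (src A) (mor A) (mor A) \<and> is_map (tgt A) (mor A) (mor A) \<and>
     is_ternary_rel (cmp A) (mor A) \<and>
     (\<forall>f\<in>Mor A. source A (source A f) = source A f \<and> target A (source A f) = source A f \<and>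
                source A (target A f) = target A f \<and> target A (target A f) = target A f) \<and>
     (\<forall>f\<in>Mor A. \<forall>g\<in>Mor A.
        (\<exists>h. triple f g h \<in> elts (cmp A)) \<longleftrightarrow> source A f = target A g) \<and>
     (\<forall>f g h h'. triple f g h \<in> elts (cmp A) \<and> triple f g h' \<in> elts (cmp A) \<longrightarrow> h = h')"

definition composition_graph_fm :: "'a small_cat \<Rightarrow> 'a fm" where
  "composition_graph_fm A =
    (let s = Ap (Cst (src A)); t = Ap (Cst (tgt A)); M = Cst (mor A) in
     And (is_map_fm (src A) (mor A)) (And (is_map_fm (tgt A) (mor A))
    (And (ternary_rel_fm (cmp A) (mor A))
    (And (All 0 M
       (And (And (Eq (s (s (Var 0))) (s (Var 0))) (Eq (t (s (Var 0))) (s (Var 0))))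
            (And (Eq (s (t (Var 0))) (t (Var 0))) (Eq (t (t (Var 0))) (t (Var 0))))))
    (And (All 0 M (All 1 M
       (And (Imp (Exi 2 M (comp_fm A 0 1 2)) (Eq (s (Var 0)) (t (Var 1))))
            (Imp (Eq (s (Var 0)) (t (Var 1))) (Exi 2 M (comp_fm A 0 1 2))))))
       (All 0 M (All 1 M (All 2 M (All 3 M
          (Imp (And (comp_fm A 0 1 2) (comp_fm A 0 1 3)) (Eq (Var 2) (Var 3))))))))))))"

lemma composition_graph_iff_sat:
  "composition_graph A \<longleftrightarrow>
     \<not> atom (src A) \<and> \<not> atom (tgt A) \<and> \<not> atom (cmp A) \<and> sat e (composition_graph_fm A)"
proof -
  have 1: "(\<forall>f\<in>Mor A. \<forall>g\<in>Mor A. (\<exists>h. triple f g h \<in> elts (cmp A)) \<longleftrightarrow> source A f = target A g) \<longleftrightarrow>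
      (\<forall>f\<in>Mor A. \<forall>g\<in>Mor A. (\<exists>h\<in>Mor A. triple f g h \<in> elts (cmp A)) \<longleftrightarrow> source A f = target A g)"
    and 2: "(\<forall>f g h h'. triple f g h \<in> elts (cmp A) \<and> triple f g h' \<in> elts (cmp A) \<longrightarrow> h = h') \<longleftrightarrow>
      (\<forall>f\<in>Mor A. \<forall>g\<in>Mor A. \<forall>h\<in>Mor A. \<forall>h'\<in>Mor A.
        triple f g h \<in> elts (cmp A) \<and> triple f g h' \<in> elts (cmp A) \<longrightarrow> h = h')"
    if r: "is_ternary_rel (cmp A) (mor A)"
  proof -
    have mem: "f \<in> Mor A \<and> g \<in> Mor A \<and> h \<in> Mor A" if "triple f g h \<in> elts (cmp A)" for f g h
      using is_ternary_rel_mem[OF r that] by (simp add: Mor_def)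
    show "(\<forall>f\<in>Mor A. \<forall>g\<in>Mor A. (\<exists>h. triple f g h \<in> elts (cmp A)) \<longleftrightarrow> source A f = target A g) \<longleftrightarrow>
      (\<forall>f\<in>Mor A. \<forall>g\<in>Mor A. (\<exists>h\<in>Mor A. triple f g h \<in> elts (cmp A)) \<longleftrightarrow> source A f = target A g)"
      using mem by meson
    show "(\<forall>f g h h'. triple f g h \<in> elts (cmp A) \<and> triple f g h' \<in> elts (cmp A) \<longrightarrow> h = h') \<longleftrightarrow>
      (\<forall>f\<in>Mor A. \<forall>g\<in>Mor A. \<forall>h\<in>Mor A. \<forall>h'\<in>Mor A.
        triple f g h \<in> elts (cmp A) \<and> triple f g h' \<in> elts (cmp A) \<longrightarrow> h = h')"
      using mem by meson
  qed
  have s: "sat e (composition_graph_fm A) \<longleftrightarrow>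
     sat e (is_map_fm (src A) (mor A)) \<and> sat e (is_map_fm (tgt A) (mor A)) \<and>
     sat e (ternary_rel_fm (cmp A) (mor A)) \<and>
     (\<forall>f\<in>Mor A. source A (source A f) = source A f \<and> target A (source A f) = source A f \<and>
                source A (target A f) = target A f \<and> target A (target A f) = target A f) \<and>
     (\<forall>f\<in>Mor A. \<forall>g\<in>Mor A.
        (\<exists>h\<in>Mor A. triple f g h \<in> elts (cmp A)) \<longleftrightarrow> source A f = target A g) \<and>
     (\<forall>f\<in>Mor A. \<forall>g\<in>Mor A. \<forall>h\<in>Mor A. \<forall>h'\<in>Mor A.
        triple f g h \<in> elts (cmp A) \<and> triple f g h' \<in> elts (cmp A) \<longrightarrow> h = h')"
    by (simp add: composition_graph_fm_def Let_def source_def target_def Mor_def iff_conv_conj_imp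
        conj_assoc)
  show ?thesis
    unfolding composition_graph_def s is_map_iff_sat[of _ _ e]
    using 1 2 is_ternary_rel_iff_sat[of "cmp A" "mor A" e] by argo
qed

lemma triple_comp_iff:
  assumes "composition_graph A"
  shows "triple f g h \<in> elts (cmp A) \<longleftrightarrow>
    f \<in> Mor A \<and> g \<in> Mor A \<and> source A f = target A g \<and> h = comp A f g"
proof -
  have r: "is_ternary_rel (cmp A) (mor A)"
    and ex: "\<And>f g. f \<in> Mor A \<Longrightarrow> g \<in> Mor A \<Longrightarrow>
      (\<exists>h. triple f g h \<in> elts (cmp A)) \<longleftrightarrow> source A f = target A g"
    and un: "\<And>f g h h'. triple f g h \<in> elts (cmp A) \<Longrightarrow> triple f g h' \<in> elts (cmp A) \<Longrightarrow> h = h'"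
    using assms unfolding composition_graph_def by blast+
  have comp: "comp A f g = h" if "triple f g h \<in> elts (cmp A)" for h
    unfolding comp_def
  proof (rule the_equality)
    show "h' = h" if "triple f g h' \<in> elts (cmp A)" for h'
      by (rule un[OF that \<open>triple f g h \<in> elts (cmp A)\<close>])
  qed (rule that)
  have mem: "f \<in> Mor A \<and> g \<in> Mor A" if "triple f g h \<in> elts (cmp A)" for h
    using is_ternary_rel_mem[OF r that] by (simp add: Mor_def)
  show ?thesis using comp mem ex by blast
qed

lemma comp_in_Mor:
  assumes "composition_graph A" "f \<in> Mor A" "g \<in> Mor A" "source A f = target A g"
  shows "comp A f g \<in> Mor A"
proof -
  have "triple f g (comp A f g) \<in> elts (cmp A)" using assms by (simp add: triple_comp_iff)
  moreover have "is_ternary_rel (cmp A) (mor A)" using assms by (simp add: composition_graph_def)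
  ultimately show ?thesis using is_ternary_rel_mem unfolding Mor_def by blast
qed

lemma ends_in_Mor:
  assumes "composition_graph A" "f \<in> Mor A"
  shows "source A f \<in> Mor A" "target A f \<in> Mor A"
  using assms app_mem[of "src A" "mor A" "mor A" f] app_mem[of "tgt A" "mor A" "mor A" f]
  by (simp_all add: composition_graph_def source_def target_def Mor_def)

text \<open>
  The remaining axioms of a category, with composites given by the composition relation. In the
  associativity law the variables 3, 4, 5 stand for \<open>f \<circ> g\<close>, \<open>(f \<circ> g) \<circ> h\<close> and \<open>g \<circ> h\<close>.
\<close>

definition category_laws_fm :: "'a small_cat \<Rightarrow> 'a fm" where
  "category_laws_fm A =
    (let s = (\<lambda>n. Ap (Cst (src A)) (Var n)); t = (\<lambda>n. Ap (Cst (tgt A)) (Var n)); M = Cst (mor A) in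
     And (All 0 M (All 1 M (All 2 M (Imp (comp_fm A 0 1 2) (And (Eq (s 2) (s 1)) (Eq (t 2) (t 0)))))))
    (And (All 0 M (And (In (Pr (Pr (Var 0) (s 0)) (Var 0)) (Cst (cmp A)))
                       (In (Pr (Pr (t 0) (Var 0)) (Var 0)) (Cst (cmp A)))))
         (All 0 M (All 1 M (All 2 M (All 3 M (All 4 M (All 5 M
            (Imp (And (comp_fm A 0 1 3) (And (comp_fm A 3 2 4) (comp_fm A 1 2 5)))
               (comp_fm A 0 5 4))))))))))"

lemma small_category_iff_sat:
  "small_category B A \<longleftrightarrow> mor A \<in> superstr B - B \<and> composition_graph A \<and> sat e (category_laws_fm A)"
proof -
  let ?ends = "\<forall>f\<in>Mor A. \<forall>g\<in>Mor A. source A f = target A g \<longrightarrow>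
        source A (comp A f g) = source A g \<and> target A (comp A f g) = target A f"
  let ?unit = "\<forall>f\<in>Mor A. comp A f (source A f) = f \<and> comp A (target A f) f = f"
  let ?assoc = "\<forall>f\<in>Mor A. \<forall>g\<in>Mor A. \<forall>h\<in>Mor A. source A f = target A g \<and> source A g = target A h \<longrightarrow>
        comp A (comp A f g) h = comp A f (comp A g h)"
  have "?ends \<and> ?unit \<and> ?assoc \<longleftrightarrow> sat e (category_laws_fm A)" if G: "composition_graph A"
  proof -
    have st: "source A f \<in> Mor A" "target A f \<in> Mor A"
        "source A (target A f) = target A f" "target A (source A f) = source A f"
      if "f \<in> Mor A" for f
      using ends_in_Mor[OF G that] G that unfolding composition_graph_def by blast+
    have c: "comp A f g \<in> Mor A" if "f \<in> Mor A" "g \<in> Mor A" "source A f = target A g" for f g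
      by (rule comp_in_Mor[OF G that])
    have "sat e (category_laws_fm A) \<longleftrightarrow>
        (\<forall>f\<in>Mor A. \<forall>g\<in>Mor A. \<forall>h\<in>Mor A. triple f g h \<in> elts (cmp A) \<longrightarrow>
           source A h = source A g \<and> target A h = target A f) \<and>
        (\<forall>f\<in>Mor A. triple f (source A f) f \<in> elts (cmp A) \<and> triple (target A f) f f \<in> elts (cmp A)) \<and>
        (\<forall>f\<in>Mor A. \<forall>g\<in>Mor A. \<forall>h\<in>Mor A. \<forall>p\<in>Mor A. \<forall>q\<in>Mor A. \<forall>r\<in>Mor A.
           triple f g p \<in> elts (cmp A) \<and> triple p h q \<in> elts (cmp A) \<and> triple g h r \<in> elts (cmp A) \<longrightarrow>
           triple f r q \<in> elts (cmp A))" (is "_ \<longleftrightarrow> ?e \<and> ?u \<and> ?a")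
      by (simp add: category_laws_fm_def Let_def triple_def source_def target_def Mor_def)
    moreover have "?e \<longleftrightarrow> ?ends" using triple_comp_iff[OF G] c by auto
    moreover have "?u \<longleftrightarrow> ?unit" using triple_comp_iff[OF G] st by auto
    moreover have "?a \<longleftrightarrow> ?assoc" if e: ?ends
    proof
      assume a: ?a
      show ?assoc
      proof (intro ballI impI)
        fix f g h assume m: "f \<in> Mor A" "g \<in> Mor A" "h \<in> Mor A"
          "source A f = target A g \<and> source A g = target A h"
        have "triple f (comp A g h) (comp A (comp A f g) h) \<in> elts (cmp A)"
          by (rule a[rule_format, of f g h "comp A f g"])
            (use m e c in \<open>simp_all add: triple_comp_iff[OF G]\<close>)
        then show "comp A (comp A f g) h = comp A f (comp A g h)"
          by (simp add: triple_comp_iff[OF G])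
      qed
    next
      assume ?assoc
      then show ?a using e by (auto simp: triple_comp_iff[OF G])
    qed
    ultimately show ?thesis by blast
  qed
  then show ?thesis unfolding small_category_def composition_graph_def by blast
qed

lemma small_categoryD:
  assumes "small_category B A"
  shows "composition_graph A"
    and "f \<in> Mor A \<Longrightarrow> source A f \<in> Obj A"
    and "f \<in> Mor A \<Longrightarrow> target A f \<in> Obj A"
proof -
  show G: "composition_graph A" using assms small_category_iff_sat by blast
  show "f \<in> Mor A \<Longrightarrow> source A f \<in> Obj A" "f \<in> Mor A \<Longrightarrow> target A f \<in> Obj A"
    using ends_in_Mor[OF G] G unfolding composition_graph_def Obj_def by blast+
qed

lemma comp_in_Hom:
  assumes "small_category B A" "f \<in> Hom A Y Z" "g \<in> Hom A X Y"
  shows "comp A f g \<in> Hom A X Z"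
proof -
  have "comp A f g \<in> Mor A"
    using comp_in_Mor[OF small_categoryD(1)[OF assms(1)]] assms by (simp add: Hom_def)
  moreover have "source A (comp A f g) = source A g \<and> target A (comp A f g) = target A f"
    using assms unfolding small_category_def Hom_def by auto
  ultimately show ?thesis using assms by (simp add: Hom_def)
qed

lemma comp_assoc:
  assumes "small_category B A" "f \<in> Hom A Y Z" "g \<in> Hom A X Y" "h \<in> Hom A V X"
  shows "comp A (comp A f g) h = comp A f (comp A g h)"
  using assms unfolding small_category_def Hom_def by auto

lemma triple_comp_Hom_iff:
  assumes "small_category B A" "f \<in> Hom A Y Z" "g \<in> Hom A X Y"
  shows "triple f g h \<in> elts (cmp A) \<longleftrightarrow> h = comp A f g"
  using assms triple_comp_iff[OF small_categoryD(1)[OF assms(1)]] by (auto simp: Hom_def)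


section \<open>Finite sums from binary sums\<close>

lemma is_sum_pair_iff:
  "is_sum A [X, Y] C [i, j] \<longleftrightarrow> C \<in> Obj A \<and> i \<in> Hom A X C \<and> j \<in> Hom A Y C \<and>
     (\<forall>T\<in>Obj A. \<forall>f\<in>Hom A X T. \<forall>g\<in>Hom A Y T.
        \<exists>!u. u \<in> Hom A C T \<and> comp A u i = f \<and> comp A u j = g)"
proof -
  have "(\<forall>fs. length fs = length [X, Y] \<and> (\<forall>k<length [X, Y]. fs ! k \<in> Hom A ([X, Y] ! k) T) \<longrightarrow>
        (\<exists>!u. u \<in> Hom A C T \<and> (\<forall>k<length [X, Y]. comp A u ([i, j] ! k) = fs ! k))) \<longleftrightarrow>
      (\<forall>f\<in>Hom A X T. \<forall>g\<in>Hom A Y T. \<exists>!u. u \<in> Hom A C T \<and> comp A u i = f \<and> comp A u j = g)"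
    (is "?l \<longleftrightarrow> ?r") for T
  proof
    assume l: ?l
    show ?r
    proof (intro ballI)
      fix f g assume "f \<in> Hom A X T" "g \<in> Hom A Y T"
      then show "\<exists>!u. u \<in> Hom A C T \<and> comp A u i = f \<and> comp A u j = g"
        using spec[OF l, of "[f, g]"] by (simp add: All_less_Suc2)
    qed
  qed (simp add: All_less_Suc2)
  then show ?thesis by (simp add: is_sum_def All_less_Suc2)
qed

text \<open>
  The empty sum is the zero object, and a sum of \<open>X # Xs\<close> is a binary sum of \<open>X\<close> and a sum
  of \<open>Xs\<close>.
\<close>

lemma finite_sums:
  assumes cat: "small_category B A" and zero: "is_zero_object A Z"
    and binary: "\<And>X Y. X \<in> Obj A \<Longrightarrow> Y \<in> Obj A \<Longrightarrow> \<exists>C i j. is_sum A [X, Y] C [i, j]"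
  shows "set Xs \<subseteq> Obj A \<Longrightarrow> \<exists>C js. is_sum A Xs C js"
proof (induction Xs)
  case Nil
  have "is_sum A [] Z []" using zero by (auto simp: is_sum_def is_zero_object_def)
  then show ?case by blast
next
  case (Cons X Xs)
  then obtain C js where C: "is_sum A Xs C js" by auto
  have C_Obj: "C \<in> Obj A" and js: "length js = length Xs"
      "\<And>k. k < length Xs \<Longrightarrow> js ! k \<in> Hom A (Xs ! k) C"
    using C by (auto simp: is_sum_def)
  have C_univ: "\<exists>!u. u \<in> Hom A C T \<and> (\<forall>k<length Xs. comp A u (js ! k) = fs ! k)"
    if "T \<in> Obj A" "length fs = length Xs" "\<And>k. k < length Xs \<Longrightarrow> fs ! k \<in> Hom A (Xs ! k) T" for T fs
    using C that unfolding is_sum_def by blast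
  obtain D i j where D: "is_sum A [X, C] D [i, j]"
    using binary[of X C] Cons.prems C_Obj by auto
  then have D_Obj: "D \<in> Obj A" and ij: "i \<in> Hom A X D" "j \<in> Hom A C D"
    and D_univ: "\<And>T f g. T \<in> Obj A \<Longrightarrow> f \<in> Hom A X T \<Longrightarrow> g \<in> Hom A C T \<Longrightarrow>
        \<exists>!u. u \<in> Hom A D T \<and> comp A u i = f \<and> comp A u j = g"
    unfolding is_sum_pair_iff by blast+
  let ?js = "i # map (comp A j) js"
  have split: "(\<forall>k<length (X # Xs). Q k) \<longleftrightarrow> Q 0 \<and> (\<forall>k<length Xs. Q (Suc k))" for Q
    by (auto simp: less_Suc_eq_0_disj)
  have "is_sum A (X # Xs) D ?js"
    unfolding is_sum_def split
  proof (intro conjI ballI allI impI)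
    show "?js ! Suc k \<in> Hom A ((X # Xs) ! Suc k) D" if "k < length Xs" for k
      using that js comp_in_Hom[OF cat ij(2) js(2)] by simp
    fix T fs
    assume T: "T \<in> Obj A" and "length fs = length (X # Xs) \<and>
      fs ! 0 \<in> Hom A ((X # Xs) ! 0) T \<and> (\<forall>k<length Xs. fs ! Suc k \<in> Hom A ((X # Xs) ! Suc k) T)"
    then obtain f gs where fs: "fs = f # gs" "length gs = length Xs" "f \<in> Hom A X T"
      "\<And>k. k < length Xs \<Longrightarrow> gs ! k \<in> Hom A (Xs ! k) T"
      by (cases fs) auto
    \<comment> \<open>Maps out of \<open>D\<close> are pairs of a map out of \<open>X\<close> and a map out of \<open>C\<close>; the latter is forced to be \<open>u\<close>.\<close>
    obtain u where u: "u \<in> Hom A C T" "\<And>k. k < length Xs \<Longrightarrow> comp A u (js ! k) = gs ! k"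
      and u_unique: "\<And>u'. u' \<in> Hom A C T \<Longrightarrow> (\<And>k. k < length Xs \<Longrightarrow> comp A u' (js ! k) = gs ! k) \<Longrightarrow> u' = u"
      using C_univ[OF T fs(2,4)] by (auto simp: Ex1_def)
    have "comp A v (comp A j (js ! k)) = comp A (comp A v j) (js ! k)"
      if "v \<in> Hom A D T" "k < length Xs" for v k
      using comp_assoc[OF cat that(1) ij(2) js(2)] that(2) by simp
    then have eq: "(v \<in> Hom A D T \<and> comp A v (?js ! 0) = fs ! 0 \<and>
        (\<forall>k<length Xs. comp A v (?js ! Suc k) = fs ! Suc k)) \<longleftrightarrow>
        v \<in> Hom A D T \<and> comp A v i = f \<and> comp A v j = u" for v
      using u u_unique[of "comp A v j"] comp_in_Hom[OF cat _ ij(2), of v T] by (auto simp: fs js)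
    show "\<exists>!v. v \<in> Hom A D T \<and> comp A v (?js ! 0) = fs ! 0 \<and>
        (\<forall>k<length Xs. comp A v (?js ! Suc k) = fs ! Suc k)"
      unfolding eq by (rule D_univ[OF T fs(3) u(1)])
  qed (use D_Obj ij js in auto)
  then show ?case by blast
qed


section \<open>Additive categories as first-order structures\<close>

text \<open>On each morphism set \<open>P\<close> restricts to the graph of a binary operation.\<close>

definition hom_operation :: "'a::urelement_universe small_cat \<Rightarrow> 'a \<Rightarrow> bool" where
  "hom_operation A P \<longleftrightarrow> (\<forall>X\<in>Obj A. \<forall>Y\<in>Obj A. \<forall>f\<in>Hom A X Y. \<forall>g\<in>Hom A X Y.
     \<exists>!h. h \<in> Hom A X Y \<and> triple f g h \<in> elts P)"

lemma triple_add_iff: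
  assumes "hom_operation A P" "X \<in> Obj A" "Y \<in> Obj A" "f \<in> Hom A X Y" "g \<in> Hom A X Y"
  shows "h \<in> Hom A X Y \<and> triple f g h \<in> elts P \<longleftrightarrow> h = add A P X Y f g"
proof -
  have ex: "\<exists>!h. h \<in> Hom A X Y \<and> triple f g h \<in> elts P"
    using assms by (simp add: hom_operation_def)
  have "add A P X Y f g = (THE h. h \<in> Hom A X Y \<and> triple f g h \<in> elts P)"
    by (simp add: add_def hom_group_def)
  then show ?thesis using theI'[OF ex] ex by auto
qed

lemma add_in_Hom:
  assumes "hom_operation A P" "X \<in> Obj A" "Y \<in> Obj A" "f \<in> Hom A X Y" "g \<in> Hom A X Y"
  shows "add A P X Y f g \<in> Hom A X Y"
  using triple_add_iff[OF assms] by blast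

lemma triple_add_Hom_iff:
  assumes "hom_operation A P" "X \<in> Obj A" "Y \<in> Obj A" "f \<in> Hom A X Y" "g \<in> Hom A X Y" "h \<in> Hom A X Y"
  shows "triple f g h \<in> elts P \<longleftrightarrow> h = add A P X Y f g"
  using triple_add_iff[OF assms(1-5)] assms(6) by blast

text \<open>
  The unit of \<open>hom_group\<close> is a description in terms of \<open>P\<close>. Commutativity makes it the unique
  left unit, so that the group axioms become first-order conditions on the operation.
\<close>

lemma comm_group_hom_group_iff:
  assumes op: "hom_operation A P" and X: "X \<in> Obj A" and Y: "Y \<in> Obj A"
  defines "H \<equiv> Hom A X Y" and "sm \<equiv> add A P X Y"
  shows "comm_group (hom_group A P X Y) \<longleftrightarrow>
     (\<forall>f\<in>H. \<forall>g\<in>H. \<forall>h\<in>H. sm (sm f g) h = sm f (sm g h)) \<and>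
     (\<forall>f\<in>H. \<forall>g\<in>H. sm f g = sm g f) \<and>
     (\<exists>z\<in>H. \<forall>f\<in>H. sm z f = f \<and> (\<exists>f'\<in>H. sm f' f = z))"
    (is "?G \<longleftrightarrow> ?assoc \<and> ?comm \<and> ?unit")
proof -
  have car: "carrier (hom_group A P X Y) = H"
    and mult: "mult (hom_group A P X Y) = sm"
    by (auto simp: hom_group_def H_def sm_def add_def fun_eq_iff)
  show ?thesis
  proof
    assume ?G
    then interpret comm_group "hom_group A P X Y" .
    have ?assoc using m_assoc by (simp add: car mult)
    moreover have ?comm using m_comm by (simp add: car mult)
    moreover have ?unit
      using l_one one_closed l_inv inv_closed unfolding car mult by metis
    ultimately show "?assoc \<and> ?comm \<and> ?unit" by blast
  next
    assume R: "?assoc \<and> ?comm \<and> ?unit"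
    then obtain z where z: "z \<in> H" "\<And>f. f \<in> H \<Longrightarrow> sm z f = f"
      "\<And>f. f \<in> H \<Longrightarrow> \<exists>f'\<in>H. sm f' f = z" by blast
    have "one (hom_group A P X Y) = (THE z. z \<in> H \<and> (\<forall>f\<in>H. sm z f = f))"
    proof -
      have "(z \<in> H \<and> (\<forall>f\<in>H. triple z f f \<in> elts P)) \<longleftrightarrow> (z \<in> H \<and> (\<forall>f\<in>H. sm z f = f))" for z
        using triple_add_Hom_iff[OF op X Y] unfolding H_def sm_def by metis
      then show ?thesis by (simp add: hom_group_def H_def)
    qed
    also have "\<dots> = z"
    proof (rule the_equality)
      fix z' assume "z' \<in> H \<and> (\<forall>f\<in>H. sm z' f = f)"
      then have "z' \<in> H" "sm z' z = z" using z(1) by blast+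
      moreover from this have "sm z z' = z'" "sm z z' = sm z' z" using z R by blast+
      ultimately show "z' = z" by simp
    qed (use z in simp)
    finally have one: "one (hom_group A P X Y) = z" .
    show ?G
      by (rule comm_groupI)
        (use R z add_in_Hom[OF op X Y] in \<open>auto simp: car mult one H_def sm_def\<close>)
  qed
qed

definition hom_operation_fm :: "'a small_cat \<Rightarrow> 'a \<Rightarrow> 'a fm" where
  "hom_operation_fm A P = AllO A 0 (AllO A 1 (AllH A 2 0 1 (AllH A 3 0 1 (ExH A 4 0 1
     (And (add_fm P 2 3 4) (AllH A 5 0 1 (Imp (add_fm P 2 3 5) (Eq (Var 5) (Var 4)))))))))"

lemma hom_operation_iff_sat: "hom_operation A P \<longleftrightarrow> sat e (hom_operation_fm A P)"
  by (simp add: hom_operation_def hom_operation_fm_def ex1_conj_iff_bex)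

text \<open>
  Associativity, commutativity, and the existence of a left unit with left inverses. In the
  associativity law the variables 5, 6, 7 stand for \<open>f + g\<close>, \<open>(f + g) + h\<close> and \<open>g + h\<close>.
\<close>

definition hom_group_fm :: "'a small_cat \<Rightarrow> 'a \<Rightarrow> 'a fm" where
  "hom_group_fm A P = AllO A 0 (AllO A 1
    (And (AllH A 2 0 1 (AllH A 3 0 1 (AllH A 4 0 1 (AllH A 5 0 1 (AllH A 6 0 1 (AllH A 7 0 1
            (Imp (And (add_fm P 2 3 5) (And (add_fm P 5 4 6) (add_fm P 3 4 7))) (add_fm P 2 7 6))))))))
    (And (AllH A 2 0 1 (AllH A 3 0 1 (AllH A 4 0 1 (Imp (add_fm P 2 3 4) (add_fm P 3 2 4)))))
         (ExH A 2 0 1 (AllH A 3 0 1 (And (add_fm P 2 3 3) (ExH A 4 0 1 (add_fm P 4 3 2))))))))"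

lemma hom_group_iff_sat:
  assumes op: "hom_operation A P"
  shows "(\<forall>X\<in>Obj A. \<forall>Y\<in>Obj A. comm_group (hom_group A P X Y)) \<longleftrightarrow> sat e (hom_group_fm A P)"
proof -
  have "sat e (hom_group_fm A P) \<longleftrightarrow> (\<forall>X\<in>Obj A. \<forall>Y\<in>Obj A.
     (\<forall>f\<in>Hom A X Y. \<forall>g\<in>Hom A X Y. \<forall>h\<in>Hom A X Y. \<forall>p\<in>Hom A X Y. \<forall>q\<in>Hom A X Y. \<forall>r\<in>Hom A X Y.
        triple f g p \<in> elts P \<and> triple p h q \<in> elts P \<and> triple g h r \<in> elts P \<longrightarrow> triple f r q \<in> elts P) \<and>
     (\<forall>f\<in>Hom A X Y. \<forall>g\<in>Hom A X Y. \<forall>h\<in>Hom A X Y. triple f g h \<in> elts P \<longrightarrow> triple g f h \<in> elts P) \<and>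
     (\<exists>z\<in>Hom A X Y. \<forall>f\<in>Hom A X Y. triple z f f \<in> elts P \<and> (\<exists>f'\<in>Hom A X Y. triple f' f z \<in> elts P)))"
    by (simp add: hom_group_fm_def)
  also have "\<dots> \<longleftrightarrow> (\<forall>X\<in>Obj A. \<forall>Y\<in>Obj A. comm_group (hom_group A P X Y))"
  proof (intro ball_cong refl)
    fix X Y assume X: "X \<in> Obj A" and Y: "Y \<in> Obj A"
    note [simp] = triple_add_Hom_iff[OF op X Y] add_in_Hom[OF op X Y]
    show "(\<forall>f\<in>Hom A X Y. \<forall>g\<in>Hom A X Y. \<forall>h\<in>Hom A X Y. \<forall>p\<in>Hom A X Y. \<forall>q\<in>Hom A X Y. \<forall>r\<in>Hom A X Y.
        triple f g p \<in> elts P \<and> triple p h q \<in> elts P \<and> triple g h r \<in> elts P \<longrightarrow> triple f r q \<in> elts P) \<and>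
     (\<forall>f\<in>Hom A X Y. \<forall>g\<in>Hom A X Y. \<forall>h\<in>Hom A X Y. triple f g h \<in> elts P \<longrightarrow> triple g f h \<in> elts P) \<and>
     (\<exists>z\<in>Hom A X Y. \<forall>f\<in>Hom A X Y. triple z f f \<in> elts P \<and> (\<exists>f'\<in>Hom A X Y. triple f' f z \<in> elts P)) \<longleftrightarrow>
     comm_group (hom_group A P X Y)" (is "?a \<and> ?c \<and> ?u \<longleftrightarrow> _")
    proof -
      have "?a \<longleftrightarrow> (\<forall>f\<in>Hom A X Y. \<forall>g\<in>Hom A X Y. \<forall>h\<in>Hom A X Y.
          add A P X Y (add A P X Y f g) h = add A P X Y f (add A P X Y g h))"
        by simp
      moreover have "?c \<longleftrightarrow> (\<forall>f\<in>Hom A X Y. \<forall>g\<in>Hom A X Y. add A P X Y f g = add A P X Y g f)"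
        by simp
      moreover have "?u \<longleftrightarrow> (\<exists>z\<in>Hom A X Y. \<forall>f\<in>Hom A X Y. add A P X Y z f = f \<and>
          (\<exists>f'\<in>Hom A X Y. add A P X Y f' f = z))"
        by (intro bex_cong ball_cong conj_cong refl) (simp_all add: eq_commute)
      ultimately show ?thesis unfolding comm_group_hom_group_iff[OF op X Y] by blast
    qed
  qed
  finally show ?thesis by blast
qed

text \<open>
  For \<open>X\<close>, \<open>Y\<close>, \<open>Z\<close> numbered 0, 1, 2, the formula states \<open>f \<circ> (g + g') = f \<circ> g + f \<circ> g'\<close>
  and \<open>(f + f') \<circ> g = f \<circ> g + f' \<circ> g\<close>. The variables 7, 8, 9 are the composites, and 6
  respectively 5 is the sum inside the parentheses.
\<close>

definition bilinear_fm :: "'a small_cat \<Rightarrow> 'a \<Rightarrow> 'a fm" where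
  "bilinear_fm A P = AllO A 0 (AllO A 1 (AllO A 2
    (And (AllH A 3 1 2 (AllH A 4 0 1 (AllH A 5 0 1 (AllH A 6 0 1
            (AllH A 7 0 2 (AllH A 8 0 2 (AllH A 9 0 2
               (Imp (And (add_fm P 4 5 6) (And (comp_fm A 3 4 7) (And (comp_fm A 3 5 8) (comp_fm A 3 6 9))))
                  (add_fm P 7 8 9)))))))))
         (AllH A 3 1 2 (AllH A 4 1 2 (AllH A 5 1 2 (AllH A 6 0 1
            (AllH A 7 0 2 (AllH A 8 0 2 (AllH A 9 0 2
               (Imp (And (add_fm P 3 4 5) (And (comp_fm A 3 6 7) (And (comp_fm A 4 6 8) (comp_fm A 5 6 9))))
                  (add_fm P 7 8 9))))))))))))"

lemma bilinear_iff_sat: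
  assumes cat: "small_category B A" and op: "hom_operation A P"
  shows "(\<forall>X\<in>Obj A. \<forall>Y\<in>Obj A. \<forall>Z\<in>Obj A.
        (\<forall>f\<in>Hom A Y Z. \<forall>g\<in>Hom A X Y. \<forall>g'\<in>Hom A X Y.
           comp A f (add A P X Y g g') = add A P X Z (comp A f g) (comp A f g')) \<and>
        (\<forall>f\<in>Hom A Y Z. \<forall>f'\<in>Hom A Y Z. \<forall>g\<in>Hom A X Y.
           comp A (add A P Y Z f f') g = add A P X Z (comp A f g) (comp A f' g))) \<longleftrightarrow>
     sat e (bilinear_fm A P)"
    (is "?bil \<longleftrightarrow> _")
proof -
  have "sat e (bilinear_fm A P) \<longleftrightarrow> (\<forall>X\<in>Obj A. \<forall>Y\<in>Obj A. \<forall>Z\<in>Obj A.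
     (\<forall>f\<in>Hom A Y Z. \<forall>g\<in>Hom A X Y. \<forall>g'\<in>Hom A X Y. \<forall>s\<in>Hom A X Y.
        \<forall>p\<in>Hom A X Z. \<forall>q\<in>Hom A X Z. \<forall>r\<in>Hom A X Z.
        triple g g' s \<in> elts P \<and> triple f g p \<in> elts (cmp A) \<and> triple f g' q \<in> elts (cmp A) \<and>
        triple f s r \<in> elts (cmp A) \<longrightarrow> triple p q r \<in> elts P) \<and>
     (\<forall>f\<in>Hom A Y Z. \<forall>f'\<in>Hom A Y Z. \<forall>s\<in>Hom A Y Z. \<forall>g\<in>Hom A X Y.
        \<forall>p\<in>Hom A X Z. \<forall>q\<in>Hom A X Z. \<forall>r\<in>Hom A X Z.
        triple f f' s \<in> elts P \<and> triple f g p \<in> elts (cmp A) \<and> triple f' g q \<in> elts (cmp A) \<and>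
        triple s g r \<in> elts (cmp A) \<longrightarrow> triple p q r \<in> elts P))"
    by (simp add: bilinear_fm_def)
  also have "\<dots> \<longleftrightarrow> ?bil"
  proof (intro ball_cong refl)
    fix X Y Z assume X: "X \<in> Obj A" and Y: "Y \<in> Obj A" and Z: "Z \<in> Obj A"
    note [simp] = comp_in_Hom[OF cat, where X = X and Y = Y and Z = Z]
      triple_comp_Hom_iff[OF cat, where X = X and Y = Y and Z = Z]
      triple_add_Hom_iff[OF op X Y] triple_add_Hom_iff[OF op Y Z] triple_add_Hom_iff[OF op X Z]
      add_in_Hom[OF op X Y] add_in_Hom[OF op Y Z] add_in_Hom[OF op X Z]
    show "(\<forall>f\<in>Hom A Y Z. \<forall>g\<in>Hom A X Y. \<forall>g'\<in>Hom A X Y. \<forall>s\<in>Hom A X Y.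
        \<forall>p\<in>Hom A X Z. \<forall>q\<in>Hom A X Z. \<forall>r\<in>Hom A X Z.
        triple g g' s \<in> elts P \<and> triple f g p \<in> elts (cmp A) \<and> triple f g' q \<in> elts (cmp A) \<and>
        triple f s r \<in> elts (cmp A) \<longrightarrow> triple p q r \<in> elts P) \<and>
      (\<forall>f\<in>Hom A Y Z. \<forall>f'\<in>Hom A Y Z. \<forall>s\<in>Hom A Y Z. \<forall>g\<in>Hom A X Y.
        \<forall>p\<in>Hom A X Z. \<forall>q\<in>Hom A X Z. \<forall>r\<in>Hom A X Z.
        triple f f' s \<in> elts P \<and> triple f g p \<in> elts (cmp A) \<and> triple f' g q \<in> elts (cmp A) \<and>
        triple s g r \<in> elts (cmp A) \<longrightarrow> triple p q r \<in> elts P) \<longleftrightarrow>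
      (\<forall>f\<in>Hom A Y Z. \<forall>g\<in>Hom A X Y. \<forall>g'\<in>Hom A X Y.
         comp A f (add A P X Y g g') = add A P X Z (comp A f g) (comp A f g')) \<and>
      (\<forall>f\<in>Hom A Y Z. \<forall>f'\<in>Hom A Y Z. \<forall>g\<in>Hom A X Y.
         comp A (add A P Y Z f f') g = add A P X Z (comp A f g) (comp A f' g))"
      by simp
  qed
  finally show ?thesis by blast
qed

text \<open>There are a zero object and binary sums.\<close>

definition sums_fm :: "'a small_cat \<Rightarrow> 'a fm" where
  "sums_fm A = And
     (ExO A 0 (AllO A 1 (And (ExH A 2 1 0 (AllH A 3 1 0 (Eq (Var 3) (Var 2))))
                             (ExH A 2 0 1 (AllH A 3 0 1 (Eq (Var 3) (Var 2)))))))
     (AllO A 0 (AllO A 1 (ExO A 2 (ExH A 3 0 2 (ExH A 4 1 2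
        (AllO A 5 (AllH A 6 0 5 (AllH A 7 1 5 (ExH A 8 2 5
           (And (And (comp_fm A 8 3 6) (comp_fm A 8 4 7))
              (AllH A 9 2 5 (Imp (And (comp_fm A 9 3 6) (comp_fm A 9 4 7)) (Eq (Var 9) (Var 8))))))))))))))"

lemma sums_iff_sat:
  assumes cat: "small_category B A"
  shows "(\<exists>Z. is_zero_object A Z) \<and> (\<forall>Xs. set Xs \<subseteq> Obj A \<longrightarrow> (\<exists>C js. is_sum A Xs C js)) \<longleftrightarrow>
    sat e (sums_fm A)"
proof -
  let ?zero = "\<exists>Z. is_zero_object A Z"
  let ?binary = "\<forall>X\<in>Obj A. \<forall>Y\<in>Obj A. \<exists>C i j. is_sum A [X, Y] C [i, j]"
  have binary: "\<exists>C i j. is_sum A [X, Y] C [i, j]"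
    if sums: "\<forall>Xs. set Xs \<subseteq> Obj A \<longrightarrow> (\<exists>C js. is_sum A Xs C js)"
      and XY: "X \<in> Obj A" "Y \<in> Obj A" for X Y
  proof -
    obtain C js where C: "is_sum A [X, Y] C js" using spec[OF sums, of "[X, Y]"] XY by auto
    then have "length js = Suc (Suc 0)" by (simp add: is_sum_def)
    then obtain i j where "js = [i, j]" by (auto simp: length_Suc_conv)
    then show ?thesis using C by blast
  qed
  have "?zero \<and> (\<forall>Xs. set Xs \<subseteq> Obj A \<longrightarrow> (\<exists>C js. is_sum A Xs C js)) \<longleftrightarrow> ?zero \<and> ?binary"
    using binary finite_sums[OF cat] by blast
  also have "\<dots> \<longleftrightarrow> sat e (sums_fm A)"
  proof -
    have "(\<exists>C i j. is_sum A [X, Y] C [i, j]) \<longleftrightarrow>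
      (\<exists>C\<in>Obj A. \<exists>i\<in>Hom A X C. \<exists>j\<in>Hom A Y C. \<forall>T\<in>Obj A. \<forall>f\<in>Hom A X T. \<forall>g\<in>Hom A Y T. \<exists>u\<in>Hom A C T.
         (triple u i f \<in> elts (cmp A) \<and> triple u j g \<in> elts (cmp A)) \<and> (\<forall>v\<in>Hom A C T.
           triple v i f \<in> elts (cmp A) \<and> triple v j g \<in> elts (cmp A) \<longrightarrow> v = u))" for X Y
    proof -
      have "is_sum A [X, Y] C [i, j] \<longleftrightarrow> C \<in> Obj A \<and> i \<in> Hom A X C \<and> j \<in> Hom A Y C \<and>
        (\<forall>T\<in>Obj A. \<forall>f\<in>Hom A X T. \<forall>g\<in>Hom A Y T. \<exists>u\<in>Hom A C T.
           (triple u i f \<in> elts (cmp A) \<and> triple u j g \<in> elts (cmp A)) \<and> (\<forall>v\<in>Hom A C T.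
             triple v i f \<in> elts (cmp A) \<and> triple v j g \<in> elts (cmp A) \<longrightarrow> v = u))" for C i j
        unfolding is_sum_pair_iff ex1_conj_iff_bex
        by (intro conj_cong ball_cong bex_cong refl)
          (simp_all add: triple_comp_Hom_iff[OF cat, where Y = C] eq_commute)
      then show ?thesis by blast
    qed
    then show ?thesis
      by (simp add: sums_fm_def is_zero_object_def ex1_iff_bex Bex_def[of "Obj A"])
  qed
  finally show ?thesis .
qed

definition additive_fm :: "'a small_cat \<Rightarrow> 'a \<Rightarrow> 'a fm" where
  "additive_fm A P = And (composition_graph_fm A) (And (category_laws_fm A)
     (And (ternary_rel_fm P (mor A)) (And (hom_operation_fm A P) (And (hom_group_fm A P)
     (And (bilinear_fm A P) (sums_fm A))))))"

text \<open>
  The formula does not say that its constants are sets rather than atoms; this is the membership in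
  \<open>superstr B - B\<close>, which \<open>*\<close> preserves as well.
\<close>

lemma additive_category_iff_sat:
  assumes B: "base_set B"
  shows "additive_category B A P \<longleftrightarrow>
    {mor A, src A, tgt A, cmp A, P} \<subseteq> superstr B - B \<and> sat e (additive_fm A P)"
proof -
  have "additive_category B A P \<longleftrightarrow> small_category B A \<and> is_ternary_rel P (mor A) \<and>
      hom_operation A P \<and> sat e (hom_group_fm A P) \<and> sat e (bilinear_fm A P) \<and> sat e (sums_fm A)"
  proof (cases "small_category B A \<and> hom_operation A P")
    case True
    then have cat: "small_category B A" and op: "hom_operation A P" by auto
    show ?thesis
      unfolding hom_group_iff_sat[OF op, symmetric] bilinear_iff_sat[OF cat op, symmetric]
        sums_iff_sat[OF cat, symmetric] additive_category_def hom_operation_def ball_conj_distrib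
      by argo
  next
    case False
    then show ?thesis unfolding additive_category_def hom_operation_def by blast
  qed
  also have "\<dots> \<longleftrightarrow> mor A \<in> superstr B - B \<and> \<not> atom (src A) \<and> \<not> atom (tgt A) \<and> \<not> atom (cmp A) \<and>
      \<not> atom P \<and> sat e (additive_fm A P)"
    unfolding additive_fm_def small_category_iff_sat[of B A e] composition_graph_iff_sat[of A e]
      is_ternary_rel_iff_sat[of P _ e] hom_operation_iff_sat[of A P e]
    by (simp only: sat.simps) blast
  also have "\<dots> \<longleftrightarrow> {mor A, src A, tgt A, cmp A, P} \<subseteq> superstr B - B \<and> sat e (additive_fm A P)"
  proof
    assume l: "mor A \<in> superstr B - B \<and> \<not> atom (src A) \<and> \<not> atom (tgt A) \<and> \<not> atom (cmp A) \<and>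
      \<not> atom P \<and> sat e (additive_fm A P)"
    then have "composition_graph A" "is_ternary_rel P (mor A)"
      unfolding composition_graph_iff_sat[of A e] is_ternary_rel_iff_sat[of P _ e]
      by (simp_all add: additive_fm_def)
    moreover have M: "mor A \<in> superstr B" using l by blast
    ultimately have "src A \<in> superstr B - B" "tgt A \<in> superstr B - B" "cmp A \<in> superstr B - B"
        "P \<in> superstr B - B"
      unfolding composition_graph_def
      using is_map_in_superstr[OF B M] ternary_rel_in_superstr[OF B M] by blast+
    then show "{mor A, src A, tgt A, cmp A, P} \<subseteq> superstr B - B \<and> sat e (additive_fm A P)"
      using l by simp
  next
    assume "{mor A, src A, tgt A, cmp A, P} \<subseteq> superstr B - B \<and> sat e (additive_fm A P)"
    then show "mor A \<in> superstr B - B \<and> \<not> atom (src A) \<and> \<not> atom (tgt A) \<and> \<not> atom (cmp A) \<and>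
      \<not> atom P \<and> sat e (additive_fm A P)"
      using mem_superstr_minus_base_iff[OF B] by blast
  qed
  finally show ?thesis .
qed


section \<open>Kernels, cokernels, images and coimages\<close>

lemma additive_categoryD:
  assumes "additive_category B A P"
  shows "small_category B A" "hom_operation A P"
    and "X \<in> Obj A \<Longrightarrow> Y \<in> Obj A \<Longrightarrow> comm_group (hom_group A P X Y)"
  using assms unfolding additive_category_def hom_operation_def by blast+

lemma zero_mor_iff:
  assumes "additive_category B A P" and X: "X \<in> Obj A" and Y: "Y \<in> Obj A"
  shows "z = zero_mor A P X Y \<longleftrightarrow> z \<in> Hom A X Y \<and> (\<forall>f\<in>Hom A X Y. triple z f f \<in> elts P)"
proof -
  note op = additive_categoryD(2)[OF assms(1)]
  have mem: "triple z f f \<in> elts P \<longleftrightarrow> add A P X Y z f = f"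
    if "z \<in> Hom A X Y" "f \<in> Hom A X Y" for z f
    using triple_add_Hom_iff[OF op X Y that that(2)] by (simp add: eq_commute)
  have "comm_group (hom_group A P X Y)" by (rule additive_categoryD(3)[OF assms])
  then have comm: "\<forall>f\<in>Hom A X Y. \<forall>g\<in>Hom A X Y. add A P X Y f g = add A P X Y g f"
    and "\<exists>z\<in>Hom A X Y. \<forall>f\<in>Hom A X Y. add A P X Y z f = f"
    unfolding comm_group_hom_group_iff[OF op X Y] by blast+
  then obtain z0 where z0: "z0 \<in> Hom A X Y" "\<forall>f\<in>Hom A X Y. triple z0 f f \<in> elts P"
    using mem by blast
  have unique: "z = z0" if "z \<in> Hom A X Y" "\<forall>f\<in>Hom A X Y. triple z f f \<in> elts P" for z
  proof -
    have "z = add A P X Y z0 z" using mem z0 that by simp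
    also have "\<dots> = add A P X Y z z0" using comm z0 that by blast
    also have "\<dots> = z0" using mem z0 that by simp
    finally show ?thesis .
  qed
  have "zero_mor A P X Y = z0"
    unfolding zero_mor_def hom_group_def monoid.simps
    by (rule the_equality) (use z0 unique in blast)+
  then show ?thesis using z0 unique by blast
qed

lemma ball_Obj_iff: "(\<forall>a\<in>elts (mor A). a \<in> Obj A \<longrightarrow> Q a) \<longleftrightarrow> (\<forall>a\<in>Obj A. Q a)"
  using Obj_imp_Mor by blast

lemma ball_Hom_iff: "(\<forall>a\<in>elts (mor A). a \<in> Hom A X Y \<longrightarrow> Q a) \<longleftrightarrow> (\<forall>a\<in>Hom A X Y. Q a)"
  using Hom_imp_Mor by blast

lemma ball_Hom_conj_iff:
  "(\<forall>a\<in>elts (mor A). a \<in> Hom A X Y \<and> R a \<longrightarrow> Q a) \<longleftrightarrow> (\<forall>a\<in>Hom A X Y. R a \<longrightarrow> Q a)"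
  using Hom_imp_Mor by blast

lemma bex_Hom_iff: "(\<exists>a\<in>elts (mor A). a \<in> Hom A X Y \<and> Q a) \<longleftrightarrow> (\<exists>a\<in>Hom A X Y. Q a)"
  using Hom_imp_Mor by blast

lemma sat_comp_zero_fm:
  assumes add: "additive_category B A P" and "{f, g, X, Y} \<inter> {10, 11} = {}"
    and XY: "e X \<in> Obj A" "e Y \<in> Obj A" and f: "e f \<in> Hom A V (e Y)" and g: "e g \<in> Hom A (e X) V"
  shows "sat e (comp_zero_fm A P f g X Y) \<longleftrightarrow> comp A (e f) (e g) = zero_mor A P (e X) (e Y)"
proof -
  have "sat e (comp_zero_fm A P f g X Y) \<longleftrightarrow> (\<exists>h\<in>elts (mor A). (triple (e f) (e g) h \<in> elts (cmp A) \<and>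
      h \<in> Hom A (e X) (e Y)) \<and> (\<forall>k\<in>Hom A (e X) (e Y). triple h k k \<in> elts P))"
    using assms(2) by (simp add: comp_zero_fm_def triple_def ball_Hom_iff)
  then show ?thesis
    unfolding zero_mor_iff[OF add XY] triple_comp_Hom_iff[OF additive_categoryD(1)[OF add] f g]
    by (auto dest: Hom_imp_Mor)
qed

lemma sat_kernel_fm:
  assumes add: "additive_category B A P" and v: "{X, Y, Z, f, g} \<subseteq> {..<10}"
  shows "sat e (kernel_fm A P X Y Z f g) \<longleftrightarrow> is_kernel A P (e X) (e Y) (e Z) (e f) (e g)"
proof -
  note cat = additive_categoryD(1)[OF add]
  have [simp]: "n \<noteq> 10" "n \<noteq> 11" "n \<noteq> 12" "n \<noteq> 13" "n \<noteq> 14" "n \<noteq> 15"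
    if "n \<in> {X, Y, Z, f, g}" for n
    using that v by auto
  have unfold: "sat e (kernel_fm A P X Y Z f g) \<longleftrightarrow>
      (e X \<in> Obj A \<and> e Y \<in> Obj A \<and> e Z \<in> Obj A \<and> e f \<in> Hom A (e X) (e Y) \<and> e g \<in> Hom A (e Z) (e X)) \<and>
      sat e (comp_zero_fm A P f g Z Y) \<and>
      (\<forall>T\<in>Obj A. \<forall>h\<in>Hom A T (e X). sat (e(14 := T, 15 := h)) (comp_zero_fm A P f 15 14 Y) \<longrightarrow>
        (\<exists>k\<in>Hom A T (e Z). triple (e g) k h \<in> elts (cmp A) \<and>
          (\<forall>k'\<in>Hom A T (e Z). triple (e g) k' h \<in> elts (cmp A) \<longrightarrow> k' = k)))"
    by (simp add: kernel_fm_def ball_Obj_iff ball_Hom_conj_iff bex_Hom_iff)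
  show ?thesis
  proof (cases "e X \<in> Obj A \<and> e Y \<in> Obj A \<and> e Z \<in> Obj A \<and>
      e f \<in> Hom A (e X) (e Y) \<and> e g \<in> Hom A (e Z) (e X)")
    case True
    then have obj: "e X \<in> Obj A" "e Y \<in> Obj A" "e Z \<in> Obj A"
      and f: "e f \<in> Hom A (e X) (e Y)" and g: "e g \<in> Hom A (e Z) (e X)" by auto
    have "sat e (comp_zero_fm A P f g Z Y) \<longleftrightarrow> comp A (e f) (e g) = zero_mor A P (e Z) (e Y)"
      by (rule sat_comp_zero_fm[OF add _ _ _ f]) (use obj g in auto)
    moreover have "sat (e(14 := T, 15 := h)) (comp_zero_fm A P f 15 14 Y) \<longleftrightarrow>
        comp A (e f) h = zero_mor A P T (e Y)" if "T \<in> Obj A" "h \<in> Hom A T (e X)" for T h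
      using sat_comp_zero_fm[OF add, of f 15 14 Y "e(14 := T, 15 := h)" "e X"] that obj f by simp
    ultimately show ?thesis
      unfolding unfold is_kernel_def ex1_conj_iff_bex using True
      by (simp add: triple_comp_Hom_iff[OF cat g] eq_commute cong: ball_cong bex_cong)
  qed (auto simp: unfold is_kernel_def)
qed

lemma sat_cokernel_fm:
  assumes add: "additive_category B A P" and v: "{X, Y, Z, f, g} \<subseteq> {..<10}"
  shows "sat e (cokernel_fm A P X Y Z f g) \<longleftrightarrow> is_cokernel A P (e X) (e Y) (e Z) (e f) (e g)"
proof -
  note cat = additive_categoryD(1)[OF add]
  have [simp]: "n \<noteq> 10" "n \<noteq> 11" "n \<noteq> 12" "n \<noteq> 13" "n \<noteq> 14" "n \<noteq> 15"
    if "n \<in> {X, Y, Z, f, g}" for n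
    using that v by auto
  have unfold: "sat e (cokernel_fm A P X Y Z f g) \<longleftrightarrow>
      (e X \<in> Obj A \<and> e Y \<in> Obj A \<and> e Z \<in> Obj A \<and> e f \<in> Hom A (e X) (e Y) \<and> e g \<in> Hom A (e Y) (e Z)) \<and>
      sat e (comp_zero_fm A P g f X Z) \<and>
      (\<forall>T\<in>Obj A. \<forall>h\<in>Hom A (e Y) T. sat (e(14 := T, 15 := h)) (comp_zero_fm A P 15 f X 14) \<longrightarrow>
        (\<exists>k\<in>Hom A (e Z) T. triple k (e g) h \<in> elts (cmp A) \<and>
          (\<forall>k'\<in>Hom A (e Z) T. triple k' (e g) h \<in> elts (cmp A) \<longrightarrow> k' = k)))"
    by (simp add: cokernel_fm_def ball_Obj_iff ball_Hom_conj_iff bex_Hom_iff)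
  show ?thesis
  proof (cases "e X \<in> Obj A \<and> e Y \<in> Obj A \<and> e Z \<in> Obj A \<and>
      e f \<in> Hom A (e X) (e Y) \<and> e g \<in> Hom A (e Y) (e Z)")
    case True
    then have obj: "e X \<in> Obj A" "e Y \<in> Obj A" "e Z \<in> Obj A"
      and f: "e f \<in> Hom A (e X) (e Y)" and g: "e g \<in> Hom A (e Y) (e Z)" by auto
    have "sat e (comp_zero_fm A P g f X Z) \<longleftrightarrow> comp A (e g) (e f) = zero_mor A P (e X) (e Z)"
      by (rule sat_comp_zero_fm[OF add _ _ _ g]) (use obj f in auto)
    moreover have "sat (e(14 := T, 15 := h)) (comp_zero_fm A P 15 f X 14) \<longleftrightarrow>
        comp A h (e f) = zero_mor A P (e X) T" if "T \<in> Obj A" "h \<in> Hom A (e Y) T" for T h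
      using sat_comp_zero_fm[OF add, of 15 f X 14 "e(14 := T, 15 := h)" "e Y"] that obj f by simp
    ultimately show ?thesis
      unfolding unfold is_cokernel_def ex1_conj_iff_bex using True
      by (simp add: triple_comp_Hom_iff[OF cat _ g] eq_commute cong: ball_cong bex_cong)
  qed (auto simp: unfold is_cokernel_def)
qed

lemma is_kernel_mem:
  "is_kernel A P X Y Z f g \<Longrightarrow> {X, Y, Z, f, g} \<subseteq> elts (mor A)"
  using Obj_imp_Mor Hom_imp_Mor by (fastforce simp: is_kernel_def)

lemma is_cokernel_mem:
  "is_cokernel A P X Y Z f g \<Longrightarrow> {X, Y, Z, f, g} \<subseteq> elts (mor A)"
  using Obj_imp_Mor Hom_imp_Mor by (fastforce simp: is_cokernel_def)

lemma sat_image_fm: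
  assumes add: "additive_category B A P" and v: "{X, Y, Z, f, g} \<subseteq> {..<5}"
  shows "sat e (image_fm A P X Y Z f g) \<longleftrightarrow> is_image A P (e X) (e Y) (e Z) (e f) (e g)"
proof -
  have [simp]: "n \<noteq> 5" "n \<noteq> 6" "n < 10" if "n \<in> {X, Y, Z, f, g}" for n
    using that v by auto
  have "sat e (image_fm A P X Y Z f g) \<longleftrightarrow> (\<exists>C\<in>elts (mor A). \<exists>c\<in>elts (mor A).
      is_cokernel A P (e X) (e Y) C (e f) c \<and> is_kernel A P (e Y) C (e Z) c (e g))"
    by (simp add: image_fm_def sat_kernel_fm[OF add] sat_cokernel_fm[OF add])
  then show ?thesis unfolding is_image_def using is_cokernel_mem by blast
qed

lemma sat_coimage_fm:
  assumes add: "additive_category B A P" and v: "{X, Y, Z, f, g} \<subseteq> {..<5}"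
  shows "sat e (coimage_fm A P X Y Z f g) \<longleftrightarrow> is_coimage A P (e X) (e Y) (e Z) (e f) (e g)"
proof -
  have [simp]: "n \<noteq> 5" "n \<noteq> 6" "n < 10" if "n \<in> {X, Y, Z, f, g}" for n
    using that v by auto
  have "sat e (coimage_fm A P X Y Z f g) \<longleftrightarrow> (\<exists>K\<in>elts (mor A). \<exists>k\<in>elts (mor A).
      is_kernel A P (e X) (e Y) K (e f) k \<and> is_cokernel A P K (e X) (e Z) k (e g))"
    by (simp add: coimage_fm_def sat_kernel_fm[OF add] sat_cokernel_fm[OF add])
  then show ?thesis unfolding is_coimage_def using is_kernel_mem by blast
qed


section \<open>Abelian categories as first-order structures\<close>

text \<open>
  The variable \<open>X\<close> (respectively \<open>Y\<close>) is the source (respectively target) of \<open>f\<close>; the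
  variables 3 to 6 are bound.
\<close>

definition mono_fm :: "'a small_cat \<Rightarrow> nat \<Rightarrow> nat \<Rightarrow> 'a fm" where
  "mono_fm A f X = AllO A 3 (AllH A 4 3 X (AllH A 5 3 X (All 6 (Cst (mor A))
     (Imp (And (comp_fm A f 4 6) (comp_fm A f 5 6)) (Eq (Var 4) (Var 5))))))"

definition epi_fm :: "'a small_cat \<Rightarrow> nat \<Rightarrow> nat \<Rightarrow> 'a fm" where
  "epi_fm A f Y = AllO A 3 (AllH A 4 Y 3 (AllH A 5 Y 3 (All 6 (Cst (mor A))
     (Imp (And (comp_fm A 4 f 6) (comp_fm A 5 f 6)) (Eq (Var 4) (Var 5))))))"

lemma sat_mono_fm:
  assumes cat: "small_category B A" and f: "e f \<in> Hom A (e X) Y" and v: "{f, X} \<inter> {3, 4, 5, 6} = {}"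
  shows "sat e (mono_fm A f X) \<longleftrightarrow> is_mono A (e f)"
proof -
  have "sat e (mono_fm A f X) \<longleftrightarrow> (\<forall>T\<in>Obj A. \<forall>g\<in>Hom A T (e X). \<forall>h\<in>Hom A T (e X). \<forall>k\<in>elts (mor A).
      triple (e f) g k \<in> elts (cmp A) \<and> triple (e f) h k \<in> elts (cmp A) \<longrightarrow> g = h)"
    using v by (simp add: mono_fm_def)
  also have "\<dots> \<longleftrightarrow> (\<forall>T\<in>Obj A. \<forall>g\<in>Hom A T (e X). \<forall>h\<in>Hom A T (e X).
      comp A (e f) g = comp A (e f) h \<longrightarrow> g = h)"
    using comp_in_Hom[OF cat f, THEN Hom_imp_Mor]
    by (intro ball_cong refl) (auto simp: triple_comp_Hom_iff[OF cat f])
  also have "\<dots> \<longleftrightarrow> is_mono A (e f)" using f by (simp add: is_mono_def Hom_def)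
  finally show ?thesis .
qed

lemma sat_epi_fm:
  assumes cat: "small_category B A" and f: "e f \<in> Hom A X (e Y)" and v: "{f, Y} \<inter> {3, 4, 5, 6} = {}"
  shows "sat e (epi_fm A f Y) \<longleftrightarrow> is_epi A (e f)"
proof -
  have "sat e (epi_fm A f Y) \<longleftrightarrow> (\<forall>T\<in>Obj A. \<forall>g\<in>Hom A (e Y) T. \<forall>h\<in>Hom A (e Y) T. \<forall>k\<in>elts (mor A).
      triple g (e f) k \<in> elts (cmp A) \<and> triple h (e f) k \<in> elts (cmp A) \<longrightarrow> g = h)"
    using v by (simp add: epi_fm_def)
  also have "\<dots> \<longleftrightarrow> (\<forall>T\<in>Obj A. \<forall>g\<in>Hom A (e Y) T. \<forall>h\<in>Hom A (e Y) T.
      comp A g (e f) = comp A h (e f) \<longrightarrow> g = h)"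
    using comp_in_Hom[OF cat _ f, THEN Hom_imp_Mor]
    by (intro ball_cong refl) (auto simp: triple_comp_Hom_iff[OF cat _ f])
  also have "\<dots> \<longleftrightarrow> is_epi A (e f)" using f by (simp add: is_epi_def Hom_def)
  finally show ?thesis .
qed

text \<open>
  For a morphism \<open>f : X \<rightarrow> Y\<close>, numbered 2, 0, 1: it has a kernel and a cokernel; if it is
  monic, then it is a kernel of some \<open>Y \<rightarrow> Z\<close>; if it is epic, then it is a cokernel of some
  \<open>Z \<rightarrow> X\<close>.
\<close>

definition abelian_fm :: "'a small_cat \<Rightarrow> 'a \<Rightarrow> 'a fm" where
  "abelian_fm A P = (let M = Cst (mor A) in AllO A 0 (AllO A 1 (AllH A 2 0 1
    (And (And (Exi 3 M (Exi 4 M (kernel_fm A P 0 1 3 2 4)))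
              (Exi 3 M (Exi 4 M (cokernel_fm A P 0 1 3 2 4))))
    (And (Imp (mono_fm A 2 0) (Exi 3 M (Exi 4 M (kernel_fm A P 1 3 0 4 2))))
         (Imp (epi_fm A 2 1) (Exi 3 M (Exi 4 M (cokernel_fm A P 3 0 1 4 2)))))))))"

lemma abelian_category_iff_sat:
  assumes add: "additive_category B A P"
  shows "abelian_category B A P \<longleftrightarrow> sat e (abelian_fm A P)"
proof -
  note cat = additive_categoryD(1)[OF add]
  have "sat e (abelian_fm A P) \<longleftrightarrow> (\<forall>X\<in>Obj A. \<forall>Y\<in>Obj A. \<forall>f\<in>Hom A X Y.
      ((\<exists>Z\<in>elts (mor A). \<exists>g\<in>elts (mor A). is_kernel A P X Y Z f g) \<and>
       (\<exists>Z\<in>elts (mor A). \<exists>g\<in>elts (mor A). is_cokernel A P X Y Z f g)) \<and>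
      (is_mono A f \<longrightarrow> (\<exists>Z\<in>elts (mor A). \<exists>g\<in>elts (mor A). is_kernel A P Y Z X g f)) \<and>
      (is_epi A f \<longrightarrow> (\<exists>Z\<in>elts (mor A). \<exists>g\<in>elts (mor A). is_cokernel A P Z X Y g f)))"
    by (simp add: abelian_fm_def Let_def sat_kernel_fm[OF add] sat_cokernel_fm[OF add]
        sat_mono_fm[OF cat] sat_epi_fm[OF cat])
  also have "\<dots> \<longleftrightarrow> (\<forall>X\<in>Obj A. \<forall>Y\<in>Obj A. \<forall>f\<in>Hom A X Y.
      ((\<exists>Z g. is_kernel A P X Y Z f g) \<and> (\<exists>Z g. is_cokernel A P X Y Z f g)) \<and>
      (is_mono A f \<longrightarrow> (\<exists>Z g. is_kernel A P Y Z X g f)) \<and>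
      (is_epi A f \<longrightarrow> (\<exists>Z g. is_cokernel A P Z X Y g f)))"
  proof -
    have "(\<exists>Z\<in>elts (mor A). \<exists>g\<in>elts (mor A). is_kernel A P X Y Z f g) \<longleftrightarrow> (\<exists>Z g. is_kernel A P X Y Z f g)"
      "(\<exists>Z\<in>elts (mor A). \<exists>g\<in>elts (mor A). is_cokernel A P X Y Z f g) \<longleftrightarrow> (\<exists>Z g. is_cokernel A P X Y Z f g)"
      "(\<exists>Z\<in>elts (mor A). \<exists>g\<in>elts (mor A). is_kernel A P Y Z X g f) \<longleftrightarrow> (\<exists>Z g. is_kernel A P Y Z X g f)"
      "(\<exists>Z\<in>elts (mor A). \<exists>g\<in>elts (mor A). is_cokernel A P Z X Y g f) \<longleftrightarrow> (\<exists>Z g. is_cokernel A P Z X Y g f)"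
      for X Y f
      using is_kernel_mem is_cokernel_mem by blast+
    then show ?thesis by simp
  qed
  also have "\<dots> \<longleftrightarrow> abelian_category B A P"
  proof -
    have "(\<forall>f. Q f \<longrightarrow> R (source A f) (target A f) f) \<longleftrightarrow>
        (\<forall>X\<in>Obj A. \<forall>Y\<in>Obj A. \<forall>f\<in>Hom A X Y. Q f \<longrightarrow> R X Y f)"
      if "\<And>f. Q f \<Longrightarrow> f \<in> Mor A" for Q R
      using that small_categoryD(2,3)[OF cat] by (auto simp: Hom_def)
    from this[of "is_mono A" "\<lambda>X Y f. \<exists>Z g. is_kernel A P Y Z X g f"]
      this[of "is_epi A" "\<lambda>X Y f. \<exists>Z g. is_cokernel A P Z X Y g f"]
    show ?thesis using add
      by (simp add: abelian_category_def is_mono_def is_epi_def ball_conj_distrib)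
  qed
  finally show ?thesis by blast
qed


section \<open>Transfer of additive and abelian categories\<close>

lemmas kernel_fm_defs = comp_zero_fm_def kernel_fm_def cokernel_fm_def image_fm_def coimage_fm_def

lemmas category_fm_defs = Let_def composition_graph_fm_def category_laws_fm_def is_map_fm_def
  ternary_rel_fm_def hom_operation_fm_def hom_group_fm_def bilinear_fm_def sums_fm_def
  mono_fm_def epi_fm_def

lemma star_cat_sel [simp]:
  "mor (star_cat h A) = h (mor A)" "src (star_cat h A) = h (src A)"
  "tgt (star_cat h A) = h (tgt A)" "cmp (star_cat h A) = h (cmp A)"
  by (simp_all add: star_cat_def)

lemma star_kernel_fms:
  "star_fm h (kernel_fm A P X Y Z f g) = kernel_fm (star_cat h A) (h P) X Y Z f g"
  "star_fm h (cokernel_fm A P X Y Z f g) = cokernel_fm (star_cat h A) (h P) X Y Z f g"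
  "star_fm h (image_fm A P X Y Z f g) = image_fm (star_cat h A) (h P) X Y Z f g"
  "star_fm h (coimage_fm A P X Y Z f g) = coimage_fm (star_cat h A) (h P) X Y Z f g"
  by (simp_all add: kernel_fm_defs fm_builder_defs)

lemma star_additive_fm: "star_fm h (additive_fm A P) = additive_fm (star_cat h A) (h P)"
  by (simp add: additive_fm_def category_fm_defs fm_builder_defs)

lemma star_abelian_fm: "star_fm h (abelian_fm A P) = abelian_fm (star_cat h A) (h P)"
  by (simp add: abelian_fm_def category_fm_defs kernel_fm_defs fm_builder_defs)

lemma set_kernel_fms:
  "set_fm (kernel_fm A P X Y Z f g) \<subseteq> {mor A, src A, tgt A, cmp A, P}"
  "set_fm (cokernel_fm A P X Y Z f g) \<subseteq> {mor A, src A, tgt A, cmp A, P}"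
  "set_fm (image_fm A P X Y Z f g) \<subseteq> {mor A, src A, tgt A, cmp A, P}"
  "set_fm (coimage_fm A P X Y Z f g) \<subseteq> {mor A, src A, tgt A, cmp A, P}"
  by (simp_all add: kernel_fm_defs fm_builder_defs)

lemma set_additive_fm: "set_fm (additive_fm A P) \<subseteq> {mor A, src A, tgt A, cmp A, P}"
  by (simp add: additive_fm_def category_fm_defs fm_builder_defs)

lemma set_abelian_fm: "set_fm (abelian_fm A P) \<subseteq> {mor A, src A, tgt A, cmp A, P}"
  by (simp add: abelian_fm_def category_fm_defs kernel_fm_defs fm_builder_defs)

lemma fv_kernel_fms:
  "fv (kernel_fm A P X Y Z f g) \<subseteq> {X, Y, Z, f, g}"
  "fv (cokernel_fm A P X Y Z f g) \<subseteq> {X, Y, Z, f, g}"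
  "fv (image_fm A P X Y Z f g) \<subseteq> {X, Y, Z, f, g}"
  "fv (coimage_fm A P X Y Z f g) \<subseteq> {X, Y, Z, f, g}"
  by (auto simp: kernel_fm_defs fm_builder_defs)

lemma fv_additive_fm: "fv (additive_fm A P) = {}"
  by (simp add: additive_fm_def category_fm_defs fm_builder_defs insert_Diff_if)

lemma fv_abelian_fm: "fv (abelian_fm A P) = {}"
  using fv_kernel_fms(1)[of A P 0 1 3 2 4] fv_kernel_fms(2)[of A P 0 1 3 2 4]
    fv_kernel_fms(1)[of A P 1 3 0 4 2] fv_kernel_fms(2)[of A P 3 0 1 4 2]
  by (auto simp: abelian_fm_def category_fm_defs fm_builder_defs)

lemma additive_category_constants:
  "base_set B \<Longrightarrow> additive_category B A P \<Longrightarrow> {mor A, src A, tgt A, cmp A, P} \<subseteq> superstr B - B"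
  using additive_category_iff_sat[of B A P undefined] by simp

lemma formula_in_category:
  assumes "base_set B" "additive_category B A P" "set_fm \<phi> \<subseteq> {mor A, src A, tgt A, cmp A, P}"
  shows "formula_in B \<phi>"
  using additive_category_constants[OF assms(1,2)] assms(3) unfolding formula_in_def by blast

lemma additive_category_star:
  assumes enl: "enlargement S W star" and add: "additive_category S A P"
  shows "additive_category W (star_cat star A) (star P)"
proof -
  note base = enlargement_base_sets[OF enl, THEN conjunct1] enlargement_base_sets[OF enl, THEN conjunct2]
  note constants = additive_category_constants[OF base(1) add]
  have "sat e (additive_fm A P)" for e using additive_category_iff_sat[OF base(1), of A P e] add by simp
  then have "sat e (star_fm star (additive_fm A P))" for e
    using transfer_closed[OF enl formula_in_category[OF base(1) add set_additive_fm] fv_additive_fm] by blast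
  moreover have "{star (mor A), star (src A), star (tgt A), star (cmp A), star P} \<subseteq> superstr W - W"
    using star_in_superstr_minus_base[OF enl] constants by blast
  ultimately show ?thesis
    unfolding additive_category_iff_sat[OF base(2), of _ _ undefined] star_additive_fm by simp
qed

lemma abelian_category_star:
  assumes enl: "enlargement S W star" and ab: "abelian_category S A P"
  shows "abelian_category W (star_cat star A) (star P)"
proof -
  have add: "additive_category S A P" using ab by (simp add: abelian_category_def)
  note base = enlargement_base_sets[OF enl, THEN conjunct1]
  have "sat e (abelian_fm A P)" for e using abelian_category_iff_sat[OF add, of e] ab by simp
  then have "sat e (star_fm star (abelian_fm A P))" for e
    using transfer_closed[OF enl formula_in_category[OF base add set_abelian_fm] fv_abelian_fm] by blast
  then show ?thesis
    unfolding abelian_category_iff_sat[OF additive_category_star[OF enl add], of undefined] star_abelian_fm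
    by blast
qed

lemma cat_functor_star:
  assumes enl: "enlargement S W star" and add: "additive_category S A P"
  shows "cat_functor A (star_cat star A) star"
proof -
  note base = enlargement_base_sets[OF enl, THEN conjunct1]
  note constants = additive_category_constants[OF base add]
  note cat = additive_categoryD(1)[OF add]
  note cat' = additive_categoryD(1)[OF additive_category_star[OF enl add]]
  have Mor: "f \<in> superstr S" if "f \<in> Mor A" for f
    using superstr_elts[OF base, of "mor A"] that constants by (simp add: Mor_def)
  have ends: "source A f \<in> Mor A" "target A f \<in> Mor A" if "f \<in> Mor A" for f
    using small_categoryD(2,3)[OF cat that] by (simp_all add: Obj_def)
  show ?thesis unfolding cat_functor_def
  proof (intro conjI ballI impI)
    fix f assume f: "f \<in> Mor A"
    show "star f \<in> Mor (star_cat star A)"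
      using star_mem_iff[OF enl Mor[OF f], of "mor A"] constants f by (simp add: Mor_def)
    show "star (source A f) = source (star_cat star A) (star f)"
      using star_app[OF enl, of "src A" f] constants Mor[OF f] Mor[OF ends(1)[OF f]] by (simp add: source_def)
    show "star (target A f) = target (star_cat star A) (star f)"
      using star_app[OF enl, of "tgt A" f] constants Mor[OF f] Mor[OF ends(2)[OF f]] by (simp add: target_def)
  next
    fix f g assume fg: "f \<in> Mor A" "g \<in> Mor A" "source A f = target A g"
    then have h: "comp A f g \<in> Mor A" by (rule comp_in_Mor[OF small_categoryD(1)[OF cat]])
    have "triple f g (comp A f g) \<in> elts (cmp A)"
      using fg by (simp add: triple_comp_iff[OF small_categoryD(1)[OF cat]])
    then have "triple (star f) (star g) (star (comp A f g)) \<in> elts (cmp (star_cat star A))"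
      using star_triple_mem[OF enl] Mor fg h constants by simp
    then show "star (comp A f g) = comp (star_cat star A) (star f) (star g)"
      using triple_comp_iff[OF small_categoryD(1)[OF cat']] by blast
  qed
qed

lemma additive_functor_star:
  assumes enl: "enlargement S W star" and add: "additive_category S A P"
  shows "additive_functor A P (star_cat star A) (star P) star"
proof -
  let ?A = "star_cat star A"
  note base = enlargement_base_sets[OF enl, THEN conjunct1]
  note constants = additive_category_constants[OF base add]
  note F = cat_functor_star[OF enl add]
  note op = additive_categoryD(2)[OF add]
  note op' = additive_categoryD(2)[OF additive_category_star[OF enl add]]
  have Obj: "star X \<in> Obj ?A" if "X \<in> Obj A" for X
    using F that unfolding cat_functor_def Obj_def by fastforce
  have Hom: "star f \<in> Hom ?A (star X) (star Y)" if "f \<in> Hom A X Y" for f X Y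
    using F that unfolding cat_functor_def Hom_def by fastforce
  have Hom_superstr: "f \<in> superstr S" if "f \<in> Hom A X Y" for f X Y
    using superstr_elts[OF base, of "mor A"] Hom_imp_Mor[OF that] constants by simp
  have "star (add A P X Y f g) = add ?A (star P) (star X) (star Y) (star f) (star g)"
    if XY: "X \<in> Obj A" "Y \<in> Obj A" and fg: "f \<in> Hom A X Y" "g \<in> Hom A X Y" for X Y f g
  proof -
    have s: "add A P X Y f g \<in> Hom A X Y" "triple f g (add A P X Y f g) \<in> elts P"
      using triple_add_iff[OF op XY fg] by blast+
    then have "triple (star f) (star g) (star (add A P X Y f g)) \<in> elts (star P)"
      using star_triple_mem[OF enl] Hom_superstr fg constants by simp
    then show ?thesis
      using triple_add_Hom_iff[OF op' Obj[OF XY(1)] Obj[OF XY(2)]] Hom s(1) fg by blast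
  qed
  then show ?thesis using F Hom
    unfolding additive_functor_def hom_def by (simp add: add_def) (simp add: hom_group_def)
qed


section \<open>Transfer of the kernel formulas and exactness\<close>

lemma expresses_kernel_fms:
  assumes "base_set B" and add: "additive_category B A P"
  shows "expresses B D (kernel_fm A P 0 1 2 3 4) (is_kernel A P)"
    and "expresses B D (cokernel_fm A P 0 1 2 3 4) (is_cokernel A P)"
    and "expresses B D (image_fm A P 0 1 2 3 4) (is_image A P)"
    and "expresses B D (coimage_fm A P 0 1 2 3 4) (is_coimage A P)"
proof -
  have constants: "{mor A, src A, tgt A, cmp A, P} \<subseteq> superstr B"
    using additive_category_constants[OF assms] by blast
  show "expresses B D (kernel_fm A P 0 1 2 3 4) (is_kernel A P)"
    "expresses B D (cokernel_fm A P 0 1 2 3 4) (is_cokernel A P)"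
    "expresses B D (image_fm A P 0 1 2 3 4) (is_image A P)"
    "expresses B D (coimage_fm A P 0 1 2 3 4) (is_coimage A P)"
    unfolding expresses_def formula_in_def
    using fv_kernel_fms[of A P 0 1 2 3 4, THEN subset_trans, of "{..<5}"]
      set_kernel_fms[of A P 0 1 2 3 4, THEN subset_trans[OF _ constants]]
    by (simp_all add: sat_kernel_fm[OF add] sat_cokernel_fm[OF add]
        sat_image_fm[OF add] sat_coimage_fm[OF add])
qed

lemma expresses_star_values:
  assumes enl: "enlargement S W star"
    and \<phi>: "expresses S (superstr S) \<phi> R"
    and star_\<phi>: "expresses W (superstr W) (star_fm star \<phi>) R'"
    and D: "{X, Y, Z, f, g} \<subseteq> superstr S"
  shows "R' (star X) (star Y) (star Z) (star f) (star g) \<longleftrightarrow> R X Y Z f g"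
proof -
  let ?xs = "[X, Y, Z, f, g]"
  have fv: "fv \<phi> \<subseteq> {..<5}" and "formula_in S \<phi>" using \<phi> by (auto simp: expresses_def)
  moreover have "?xs ! n \<in> superstr S" if "n \<in> fv \<phi>" for n
  proof -
    have "?xs ! n \<in> set ?xs" by (rule nth_mem) (use that fv in auto)
    moreover have "set ?xs \<subseteq> superstr S" using D by simp
    ultimately show ?thesis by blast
  qed
  ultimately have "sat ((!) ?xs) \<phi> \<longleftrightarrow> sat (star \<circ> (!) ?xs) (star_fm star \<phi>)"
    by (intro transfer_sat[OF enl]) auto
  also have "\<dots> \<longleftrightarrow> sat ((!) (map star ?xs)) (star_fm star \<phi>)"
    by (rule sat_cong) (use fv nth_map[of _ ?xs star] in \<open>auto simp del: nth_map list.map\<close>)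
  finally show ?thesis
    using \<phi> star_\<phi> D star_in_superstr[OF enl] by (simp add: expresses_def)
qed

text \<open>
  Internal elements are in general not values of \<open>*\<close>; they are members of such values, over which
  a transferred closed formula can quantify.
\<close>

lemma expresses_star:
  assumes enl: "enlargement S W star"
    and \<phi>: "expresses S (superstr S) \<phi> R" and \<psi>: "expresses S (superstr S) \<psi> R"
    and star_\<psi>: "expresses W (superstr W) (star_fm star \<psi>) R'"
  shows "expresses W (internal S star) (star_fm star \<phi>) R'"
  unfolding expresses_def
proof (intro conjI ballI)
  have base: "base_set S" "base_set W" using enlargement_base_sets[OF enl] by auto
  show "formula_in W (star_fm star \<phi>)"
    using \<phi> formula_in_star_fm[OF enl] by (simp add: expresses_def)
  show "fv (star_fm star \<phi>) \<subseteq> {..<5}" using \<phi> by (simp add: expresses_def)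
  fix X Y Z f g
  assume int: "X \<in> internal S star" "Y \<in> internal S star" "Z \<in> internal S star"
    "f \<in> internal S star" "g \<in> internal S star"
  then obtain D0 D1 D2 D3 D4 where D: "{D0, D1, D2, D3, D4} \<subseteq> superstr S"
    "X \<in> elts (star D0)" "Y \<in> elts (star D1)" "Z \<in> elts (star D2)" "f \<in> elts (star D3)" "g \<in> elts (star D4)"
    unfolding internal_def by blast
  let ?iff = "And (Imp \<phi> \<psi>) (Imp \<psi> \<phi>)"
  let ?\<chi> = "All 0 (Cst D0) (All 1 (Cst D1) (All 2 (Cst D2) (All 3 (Cst D3) (All 4 (Cst D4) ?iff))))"
  have five: "n = 0 \<or> n = 1 \<or> n = 2 \<or> n = 3 \<or> n = 4" if "n < 5" for n :: nat
    using that by arith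
  have fv: "fv \<phi> \<subseteq> {..<5}" "fv \<psi> \<subseteq> {..<5}" using \<phi> \<psi> by (auto simp: expresses_def)
  have env: "sat (e(0 := x0, Suc 0 := x1, 2 := x2, 3 := x3, 4 := x4)) \<xi> \<longleftrightarrow> sat ((!) [x0, x1, x2, x3, x4]) \<xi>"
    if "fv \<xi> \<subseteq> {..<5}" for e :: "nat \<Rightarrow> 'a" and x0 x1 x2 x3 x4 \<xi>
    by (rule sat_cong) (use that five in fastforce)
  note [simp] = env[OF fv(1)] env[OF fv(2)] env[of "star_fm star \<phi>", simplified, OF fv(1)]
    env[of "star_fm star \<psi>", simplified, OF fv(2)]
  have "sat e ?\<chi>" for e
  proof -
    have "sat ((!) [x0, x1, x2, x3, x4]) \<phi> \<longleftrightarrow> sat ((!) [x0, x1, x2, x3, x4]) \<psi>"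
      if "x0 \<in> elts D0" "x1 \<in> elts D1" "x2 \<in> elts D2" "x3 \<in> elts D3" "x4 \<in> elts D4" for x0 x1 x2 x3 x4
    proof -
      have "{x0, x1, x2, x3, x4} \<subseteq> superstr S" using that D(1) superstr_elts[OF base(1)] by blast
      then show ?thesis using \<phi> \<psi> by (simp add: expresses_def)
    qed
    then show ?thesis by simp
  qed
  moreover have "formula_in S ?\<chi>"
    using \<phi> \<psi> D(1) by (simp add: expresses_def formula_in_def Imp_def)
  moreover have "fv ?\<chi> = {}" using fv five by (fastforce simp: Imp_def)
  ultimately have "sat e (star_fm star ?\<chi>)" for e using transfer_closed[OF enl] by blast
  then have "sat ((!) [X, Y, Z, f, g]) (star_fm star \<phi>) \<longleftrightarrow> sat ((!) [X, Y, Z, f, g]) (star_fm star \<psi>)"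
    using D(2-) by (simp add: Imp_def) blast
  also have "\<dots> \<longleftrightarrow> R' X Y Z f g"
  proof -
    have "{X, Y, Z, f, g} \<subseteq> superstr W"
      using D superstr_elts[OF base(2)] star_in_superstr[OF enl] by blast
    then show ?thesis using star_\<psi> by (simp add: expresses_def)
  qed
  finally show "sat ((!) [X, Y, Z, f, g]) (star_fm star \<phi>) \<longleftrightarrow> R' X Y Z f g" .
qed

lemma is_kernel_star:
  assumes enl: "enlargement S W star" and add: "additive_category S A P"
    and k: "is_kernel A P X Y Z f g"
  shows "is_kernel (star_cat star A) (star P) (star X) (star Y) (star Z) (star f) (star g)"
proof -
  note base = enlargement_base_sets[OF enl]
  have "{X, Y, Z, f, g} \<subseteq> superstr S"
    using is_kernel_mem[OF k] superstr_elts[of S "mor A"] base additive_category_constants[OF _ add]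
    by blast
  then show ?thesis
    using expresses_star_values[OF enl expresses_kernel_fms(1)[OF base[THEN conjunct1] add]
        expresses_kernel_fms(1)[OF base[THEN conjunct2] additive_category_star[OF enl add],
          folded star_kernel_fms(1)]] k
    by blast
qed

lemma is_cokernel_star:
  assumes enl: "enlargement S W star" and add: "additive_category S A P"
    and k: "is_cokernel A P X Y Z f g"
  shows "is_cokernel (star_cat star A) (star P) (star X) (star Y) (star Z) (star f) (star g)"
proof -
  note base = enlargement_base_sets[OF enl]
  have "{X, Y, Z, f, g} \<subseteq> superstr S"
    using is_cokernel_mem[OF k] superstr_elts[of S "mor A"] base additive_category_constants[OF _ add]
    by blast
  then show ?thesis
    using expresses_star_values[OF enl expresses_kernel_fms(2)[OF base[THEN conjunct1] add]
        expresses_kernel_fms(2)[OF base[THEN conjunct2] additive_category_star[OF enl add],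
          folded star_kernel_fms(2)]] k
    by blast
qed

lemma exact_functor_star:
  assumes enl: "enlargement S W star" and add: "additive_category S A P"
  shows "exact_functor A P (star_cat star A) (star P) star"
  unfolding exact_functor_def exact_seq_def is_image_def
  using additive_functor_star[OF enl add] is_kernel_star[OF enl add] is_cokernel_star[OF enl add]
  by blast

theorem proposition4p4:
  fixes S W :: "'a::urelement_universe set"
    and star :: "'a \<Rightarrow> 'a"
    and A :: "'a small_cat"
    and P :: 'a
  assumes "enlargement S W star"
    and "additive_category S A P"
  shows
    "(additive_category W (star_cat star A) (star P) \<and>
      additive_functor A P (star_cat star A) (star P) star)
     \<and>
     (\<forall>(Q, R) \<in> {(kernel_fm, is_kernel), (cokernel_fm, is_cokernel),
                  (image_fm, is_image), (coimage_fm, is_coimage)}.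
        expresses S (superstr S) (Q A P 0 1 2 3 4) (R A P) \<and>
        star_fm star (Q A P 0 1 2 3 4) = Q (star_cat star A) (star P) 0 1 2 3 4 \<and>
        expresses W (superstr W) (star_fm star (Q A P 0 1 2 3 4)) (R (star_cat star A) (star P)) \<and>
        (\<forall>\<phi>. expresses S (superstr S) \<phi> (R A P) \<longrightarrow>
             expresses W (internal S star) (star_fm star \<phi>) (R (star_cat star A) (star P))))
     \<and>
     (abelian_category S A P \<longrightarrow>
        abelian_category W (star_cat star A) (star P) \<and>
        exact_functor A P (star_cat star A) (star P) star)"
proof -
  have base: "base_set S" "base_set W" using enlargement_base_sets[OF assms(1)] by auto
  note add' = additive_category_star[OF assms]
  have step: "expresses S (superstr S) (Q A P 0 1 2 3 4) (R A P) \<and>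
      star_fm star (Q A P 0 1 2 3 4) = Q (star_cat star A) (star P) 0 1 2 3 4 \<and>
      expresses W (superstr W) (star_fm star (Q A P 0 1 2 3 4)) (R (star_cat star A) (star P)) \<and>
      (\<forall>\<phi>. expresses S (superstr S) \<phi> (R A P) \<longrightarrow>
           expresses W (internal S star) (star_fm star \<phi>) (R (star_cat star A) (star P)))"
    if "expresses S (superstr S) (Q A P 0 1 2 3 4) (R A P)"
      and "star_fm star (Q A P 0 1 2 3 4) = Q (star_cat star A) (star P) 0 1 2 3 4"
      and "expresses W (superstr W) (Q (star_cat star A) (star P) 0 1 2 3 4) (R (star_cat star A) (star P))"
    for Q :: "'a small_cat \<Rightarrow> 'a \<Rightarrow> nat \<Rightarrow> nat \<Rightarrow> nat \<Rightarrow> nat \<Rightarrow> nat \<Rightarrow> 'a fm" and R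
    using that expresses_star[OF assms(1) _ that(1)] by simp
  note S = expresses_kernel_fms[OF base(1) assms(2)]
  note W = expresses_kernel_fms[OF base(2) add']
  have "\<forall>(Q, R) \<in> {(kernel_fm, is_kernel), (cokernel_fm, is_cokernel),
                  (image_fm, is_image), (coimage_fm, is_coimage)}.
        expresses S (superstr S) (Q A P 0 1 2 3 4) (R A P) \<and>
        star_fm star (Q A P 0 1 2 3 4) = Q (star_cat star A) (star P) 0 1 2 3 4 \<and>
        expresses W (superstr W) (star_fm star (Q A P 0 1 2 3 4)) (R (star_cat star A) (star P)) \<and>
        (\<forall>\<phi>. expresses S (superstr S) \<phi> (R A P) \<longrightarrow>
             expresses W (internal S star) (star_fm star \<phi>) (R (star_cat star A) (star P)))"
    unfolding ball_simps prod.case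
    by (rule conjI, rule step[of kernel_fm is_kernel, OF S(1) star_kernel_fms(1) W(1)],
        rule conjI, rule step[of cokernel_fm is_cokernel, OF S(2) star_kernel_fms(2) W(2)],
        rule conjI, rule step[of image_fm is_image, OF S(3) star_kernel_fms(3) W(3)],
        rule conjI, rule step[of coimage_fm is_coimage, OF S(4) star_kernel_fms(4) W(4)], rule TrueI)
  moreover have "abelian_category S A P \<longrightarrow> abelian_category W (star_cat star A) (star P) \<and>
      exact_functor A P (star_cat star A) (star P) star"
    using abelian_category_star[OF assms(1)] exact_functor_star[OF assms] by simp
  ultimately show ?thesis
    using add' additive_functor_star[OF assms] by (intro conjI)
qed

end
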